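(* Let $h:A\to B$ be a homomorphism between classical bicategories. If $h$ is proper then there exists an omega pseudo-functor $\mathbf F:\mathbf X\to\mathbf Y$ where $\mathbf X,\mathbf Y$ are $2$-skeletal weak omega categories, $X_1=A$, $Y_1=B$ and $F_1=h$.
   Context: A globular set $X$ is a sequence of sets $X_i$ ($i\ge 0$; elements are called $i$-cells) with functions $dom_{i-1}^i,cod_{i-1}^i:X_i\to X_{i-1}$ ($i>0$) satisfying $dom_{i-1}^i dom_i^{i+1}=dom_{i-1}^i cod_i^{i+1}$ and $cod_{i-1}^i dom_i^{i+1}=cod_{i-1}^i cod_i^{i+1}$. For $i<j$, $dom_i^j,cod_i^j:X_j\to X_i$ are the iterated composites. An omega graph is a globular set with functions $id_i^{i-1}:X_{i-1}\to X_i$ ($i>0$) with $dom_{i-1}^i id_i^{i-1}x=x=cod_{i-1}^i id_i^{i-1}x$; $id_j^i$ denotes the iterated composite $X_i\to X_j$. Cells in the image of $id_i^{i-1}$ are identity cells; an omega graph is $n$-skeletal if every cell of dimension $>n$ is an identity cell. An omega magma is an omega graph with, for all $0\le i<j$, a partial binary operation $a\circ_i^j b$ on $j$-cells, defined exactly when $cod_i^j a=dom_i^j b$, such that: if $i+1=j$, then $dom_i^j(a\circ_i^j b)=dom_i^j a$ and $cod_i^j(a\circ_i^j b)=cod_i^j b$; if $i+1<j$, then $dom_{j-1}^j(a\circ_i^j b)=dom_{j-1}^ja\circ_i^{j-1}dom_{j-1}^jb$ and likewise for $cod_{j-1}^j$. Morphisms of globular sets, omega graphs and omega magmas preserve all the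 respective structure. A strict omega category is an omega magma in which (whenever the composites are defined) $(a\circ_i^jb)\circ_i^jc=a\circ_i^j(b\circ_i^jc)$; $(a\circ_j^kb)\circ_i^k(c\circ_j^kd)=(a\circ_i^kc)\circ_j^k(b\circ_i^kd)$ for $i<j<k$; $a=id_j^i(dom_i^ja)\circ_i^ja=a\circ_i^jid_j^i(cod_i^ja)$; and $id_{j+1}^j(a)\circ_i^{j+1}id_{j+1}^j(b)=id_{j+1}^j(a\circ_i^jb)$ for $i<j$. Two $i$-cells $a,b$ are parallel, $a\parallel b$, if they have the same $dom_{i-1}^i$ and the same $cod_{i-1}^i$; any two $0$-cells are parallel. A bridge relation $R$ on an omega graph (or omega magma) $X$ is a sequence $R_i\subseteq X_i\times X_i\times X_{i+1}$ ($i\ge0$) such that: $(a,b,c)\in R_i$ implies $a\parallel b$, $dom_i^{i+1}c=a$, $cod_i^{i+1}c=b$; $(a,a,id_{i+1}^ia)\in R_i$ for all $a\in X_i$; $(a,b,c),(a,b,d)\in R_i$ implies $c=d$. The diagonal bridge relation $R^\Delta$ consists of all triples $(a,a,id_{i+1}^ia)$. A bridge morphism $F:(X,R^X)\to(Y,R^Y)$ is an omega magma morphism with $(a,b,c)\in R_i^X\Rightarrow(Fa,Fb,Fc)\in R_i^Y$. A categorical Penon morphism is a bridge morphism $F:(X,R^X)\to(Y,R^Y)$ such that $Y$ is a strict omega category, $R^Y=R^\Delta$; $(a,b,c)\in R_i^X$ implies $Fa=Fb$ and $Fc=id_{i+1}^i(Fa)$; and if $a,b\in X_i$, $a\parallel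 b$, $Fa=Fb$, then there is $c$ with $(a,b,c)\in R_i^X$. A weak omega category $\mathbf X$ consists of omega magmas $X_1$ (the underlying magma) and $X_2$, an omega magma morphism $\lambda^X:X_2\to X_1$, a morphism $\rho^X:X_1\to X_2$ of omega graphs with $\lambda^X\circ\rho^X=1$ (as omega graph morphisms), a bridge relation $R^X$ on $X_2$, a strict omega category $X_3$, and a categorical Penon morphism $\kappa^X:(X_2,R^X)\to(X_3,R^\Delta)$. It is $n$-skeletal if $X_1$ is $n$-skeletal. An omega pseudo-functor $\mathbf F:\mathbf X\to\mathbf Y$ is a triple of morphisms of globular sets $F_i:X_i\to Y_i$ ($i=1,2,3$) such that $F_3$ is a morphism of omega graphs; $F_1\lambda^X=\lambda^YF_2$ and $F_3\kappa^X=\kappa^YF_2$ as morphisms of globular sets; and $\kappa^Y(F_2a\circ_{j-1}^jF_2b)=\kappa^YF_2(a\circ_{j-1}^jb)$ whenever $a\circ_{j-1}^jb$ is defined in $X_2$. A bicategory is regarded as a $2$-skeletal omega magma: $\circ_0^1$ and $\circ_0^2$ are horizontal composition of $1$- and $2$-cells, $\circ_1^2$ is vertical composition, and all cells above dimension $2$ are identities. A homomorphism $H:A\to B$ of bicategories (in the classical sense; a pseudo-functor) has coherence $2$-cell isomorphisms $\phi_{f,g}:Hf\circ_0^1Hg\to H(f\circ_0^1g)$ and $\phi_a:id_1^0(Ha)\to H(id_1^0a)$, natural and satisfying the usual axioms. It is proper if: (1) for all $1$-cells $f,g$, $Hf\circ_0^1Hg=H(f\circ_0^1g)$ implies $\phi_{f,g}=id_2^1(H(f\circ_0^1g))$;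 (2) for all $0$-cells $a$, $id_1^0(Ha)=H(id_1^0a)$ implies $\phi_a=id_2^1(H(id_1^0a))$; (3) for all $1$-cells $f,f',g,g'$, $f\circ_0^1g=f'\circ_0^1g'$ and $Hf\circ_0^1Hg=Hf'\circ_0^1Hg'$ implies $\phi_{f,g}=\phi_{f',g'}$; (4) for all $0$-cells $a,b$, $Ha=Hb$ and $H(id_1^0a)=H(id_1^0b)$ implies $\phi_a=\phi_b$. *)

theory Defs
  imports Main
begin

section \<open>Globular sets, omega graphs, omega magmas\<close>

text \<open>
  All cells of a structure live in one type; the sets of cells of different dimensions are not
  required to be disjoint. The boundary map \<open>gdom X i\<close> goes from \<open>(i+1)\<close>-cells to \<open>i\<close>-cells
  and \<open>gid X i\<close> goes from \<open>i\<close>-cells to \<open>(i+1)\<close>-cells. All operations are total functions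
  whose values matter only on the relevant cells.
\<close>

record 'a globular_set =
  cells :: "nat \<Rightarrow> 'a set"
  gdom :: "nat \<Rightarrow> 'a \<Rightarrow> 'a"
  gcod :: "nat \<Rightarrow> 'a \<Rightarrow> 'a"

locale globular_set =
  fixes X :: "('a, 'm) globular_set_scheme"
  assumes gdom_closed: "x \<in> cells X (Suc i) \<Longrightarrow> gdom X i x \<in> cells X i"
    and gcod_closed: "x \<in> cells X (Suc i) \<Longrightarrow> gcod X i x \<in> cells X i"
    and gdom_gdom: "x \<in> cells X (Suc (Suc i)) \<Longrightarrow>
          gdom X i (gdom X (Suc i) x) = gdom X i (gcod X (Suc i) x)"
    and gcod_gdom: "x \<in> cells X (Suc (Suc i)) \<Longrightarrow>
          gcod X i (gdom X (Suc i) x) = gcod X i (gcod X (Suc i) x)"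

text \<open>Iterated boundaries: \<open>dom_it X i j\<close> goes from \<open>j\<close>-cells to \<open>i\<close>-cells, for \<open>i \<le> j\<close>.\<close>

primrec dom_it :: "('a, 'm) globular_set_scheme \<Rightarrow> nat \<Rightarrow> nat \<Rightarrow> 'a \<Rightarrow> 'a" where
  "dom_it X i 0 x = x"
| "dom_it X i (Suc j) x = (if i \<le> j then dom_it X i j (gdom X j x) else x)"

primrec cod_it :: "('a, 'm) globular_set_scheme \<Rightarrow> nat \<Rightarrow> nat \<Rightarrow> 'a \<Rightarrow> 'a" where
  "cod_it X i 0 x = x"
| "cod_it X i (Suc j) x = (if i \<le> j then cod_it X i j (gcod X j x) else x)"

definition parallel :: "('a, 'm) globular_set_scheme \<Rightarrow> nat \<Rightarrow> 'a \<Rightarrow> 'a \<Rightarrow> bool" where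
  "parallel X i a b \<longleftrightarrow> a \<in> cells X i \<and> b \<in> cells X i \<and>
     (\<forall>k. i = Suc k \<longrightarrow> gdom X k a = gdom X k b \<and> gcod X k a = gcod X k b)"

record 'a omega_graph = "'a globular_set" +
  gid :: "nat \<Rightarrow> 'a \<Rightarrow> 'a"

locale omega_graph = globular_set X for X :: "('a, 'm) omega_graph_scheme" +
  assumes gid_closed: "x \<in> cells X i \<Longrightarrow> gid X i x \<in> cells X (Suc i)"
    and gdom_gid: "x \<in> cells X i \<Longrightarrow> gdom X i (gid X i x) = x"
    and gcod_gid: "x \<in> cells X i \<Longrightarrow> gcod X i (gid X i x) = x"

text \<open>\<open>id_it X i j\<close> goes from \<open>i\<close>-cells to \<open>j\<close>-cells, for \<open>i \<le> j\<close>.\<close>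

primrec id_it :: "('a, 'm) omega_graph_scheme \<Rightarrow> nat \<Rightarrow> nat \<Rightarrow> 'a \<Rightarrow> 'a" where
  "id_it X i 0 x = x"
| "id_it X i (Suc j) x = (if i \<le> j then gid X j (id_it X i j x) else x)"

definition skeletal :: "nat \<Rightarrow> ('a, 'm) omega_graph_scheme \<Rightarrow> bool" where
  "skeletal n X \<longleftrightarrow> (\<forall>i\<ge>n. \<forall>x\<in>cells X (Suc i). \<exists>y\<in>cells X i. x = gid X i y)"

text \<open>\<open>gcomp X i j a b\<close> composes the \<open>j\<close>-cells \<open>a\<close> and \<open>b\<close> along an \<open>i\<close>-cell, in diagrammatic order.\<close>

record 'a omega_magma = "'a omega_graph" +
  gcomp :: "nat \<Rightarrow> nat \<Rightarrow> 'a \<Rightarrow> 'a \<Rightarrow> 'a"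

definition composable ::
    "('a, 'm) globular_set_scheme \<Rightarrow> nat \<Rightarrow> nat \<Rightarrow> 'a \<Rightarrow> 'a \<Rightarrow> bool" where
  "composable X i j a b \<longleftrightarrow>
     i < j \<and> a \<in> cells X j \<and> b \<in> cells X j \<and> cod_it X i j a = dom_it X i j b"

locale omega_magma = omega_graph X for X :: "('a, 'm) omega_magma_scheme" +
  assumes gcomp_closed: "composable X i j a b \<Longrightarrow> gcomp X i j a b \<in> cells X j"
    and gdom_gcomp: "composable X i (Suc i) a b \<Longrightarrow>
          gdom X i (gcomp X i (Suc i) a b) = gdom X i a"
    and gcod_gcomp: "composable X i (Suc i) a b \<Longrightarrow>
          gcod X i (gcomp X i (Suc i) a b) = gcod X i b"
    and gdom_gcomp_less: "i < j \<Longrightarrow> composable X i (Suc j) a b \<Longrightarrow>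
          gdom X j (gcomp X i (Suc j) a b) = gcomp X i j (gdom X j a) (gdom X j b)"
    and gcod_gcomp_less: "i < j \<Longrightarrow> composable X i (Suc j) a b \<Longrightarrow>
          gcod X j (gcomp X i (Suc j) a b) = gcomp X i j (gcod X j a) (gcod X j b)"

text \<open>In the interchange law, definedness of the left side entails that of the right side.\<close>

locale strict_omega_category = omega_magma X for X :: "('a, 'm) omega_magma_scheme" +
  assumes gcomp_assoc: "composable X i j a b \<Longrightarrow> composable X i j b c \<Longrightarrow>
          gcomp X i j (gcomp X i j a b) c = gcomp X i j a (gcomp X i j b c)"
    and interchange: "i < j \<Longrightarrow> j < k \<Longrightarrow>
          composable X j k a b \<Longrightarrow> composable X j k c d \<Longrightarrow>
          composable X i k (gcomp X j k a b) (gcomp X j k c d) \<Longrightarrow>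
          gcomp X i k (gcomp X j k a b) (gcomp X j k c d) =
          gcomp X j k (gcomp X i k a c) (gcomp X i k b d)"
    and gcomp_unit_left: "i < j \<Longrightarrow> a \<in> cells X j \<Longrightarrow>
          gcomp X i j (id_it X i j (dom_it X i j a)) a = a"
    and gcomp_unit_right: "i < j \<Longrightarrow> a \<in> cells X j \<Longrightarrow>
          gcomp X i j a (id_it X i j (cod_it X i j a)) = a"
    and gcomp_gid: "composable X i j a b \<Longrightarrow>
          gcomp X i (Suc j) (gid X j a) (gid X j b) = gid X j (gcomp X i j a b)"


section \<open>Morphisms\<close>

locale globular_morphism = X: globular_set X + Y: globular_set Y
  for X :: "('a, 'm) globular_set_scheme" and Y :: "('b, 'n) globular_set_scheme" +
  fixes F :: "nat \<Rightarrow> 'a \<Rightarrow> 'b"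
  assumes map_closed: "x \<in> cells X i \<Longrightarrow> F i x \<in> cells Y i"
    and map_gdom: "x \<in> cells X (Suc i) \<Longrightarrow> F i (gdom X i x) = gdom Y i (F (Suc i) x)"
    and map_gcod: "x \<in> cells X (Suc i) \<Longrightarrow> F i (gcod X i x) = gcod Y i (F (Suc i) x)"

locale omega_graph_morphism = globular_morphism X Y F + X: omega_graph X + Y: omega_graph Y
  for X :: "('a, 'm) omega_graph_scheme" and Y :: "('b, 'n) omega_graph_scheme"
    and F :: "nat \<Rightarrow> 'a \<Rightarrow> 'b" +
  assumes map_gid: "x \<in> cells X i \<Longrightarrow> F (Suc i) (gid X i x) = gid Y i (F i x)"

locale omega_magma_morphism = omega_graph_morphism X Y F + X: omega_magma X + Y: omega_magma Y
  for X :: "('a, 'm) omega_magma_scheme" and Y :: "('b, 'n) omega_magma_scheme"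
    and F :: "nat \<Rightarrow> 'a \<Rightarrow> 'b" +
  assumes map_gcomp: "composable X i j a b \<Longrightarrow>
          F j (gcomp X i j a b) = gcomp Y i j (F j a) (F j b)"


section \<open>Bridge relations and categorical Penon morphisms\<close>

locale bridge_relation = omega_graph X for X :: "('a, 'm) omega_graph_scheme" +
  fixes R :: "nat \<Rightarrow> ('a \<times> 'a \<times> 'a) set"
  assumes bridge_cells: "R i \<subseteq> cells X i \<times> cells X i \<times> cells X (Suc i)"
    and bridge_parallel: "(a, b, c) \<in> R i \<Longrightarrow> parallel X i a b"
    and bridge_gdom: "(a, b, c) \<in> R i \<Longrightarrow> gdom X i c = a"
    and bridge_gcod: "(a, b, c) \<in> R i \<Longrightarrow> gcod X i c = b"
    and bridge_gid: "a \<in> cells X i \<Longrightarrow> (a, a, gid X i a) \<in> R i"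
    and bridge_unique: "(a, b, c) \<in> R i \<Longrightarrow> (a, b, d) \<in> R i \<Longrightarrow> c = d"

definition diagonal_bridge ::
    "('a, 'm) omega_graph_scheme \<Rightarrow> nat \<Rightarrow> ('a \<times> 'a \<times> 'a) set" where
  "diagonal_bridge X i = {(a, a, gid X i a) | a. a \<in> cells X i}"

locale bridge_morphism =
  omega_magma_morphism X Y F + X: bridge_relation X R + Y: bridge_relation Y S
  for X :: "('a, 'm) omega_magma_scheme" and R :: "nat \<Rightarrow> ('a \<times> 'a \<times> 'a) set"
    and Y :: "('b, 'n) omega_magma_scheme" and S :: "nat \<Rightarrow> ('b \<times> 'b \<times> 'b) set"
    and F :: "nat \<Rightarrow> 'a \<Rightarrow> 'b" +
  assumes map_bridge: "(a, b, c) \<in> R i \<Longrightarrow> (F i a, F i b, F (Suc i) c) \<in> S i"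

locale categorical_penon_morphism = bridge_morphism X R Y S F + Y: strict_omega_category Y
  for X :: "('a, 'm) omega_magma_scheme" and R :: "nat \<Rightarrow> ('a \<times> 'a \<times> 'a) set"
    and Y :: "('b, 'n) omega_magma_scheme" and S :: "nat \<Rightarrow> ('b \<times> 'b \<times> 'b) set"
    and F :: "nat \<Rightarrow> 'a \<Rightarrow> 'b" +
  assumes target_diagonal: "S = diagonal_bridge Y"
    and bridge_collapse: "(a, b, c) \<in> R i \<Longrightarrow> F i a = F i b \<and> F (Suc i) c = gid Y i (F i a)"
    and bridge_exists: "parallel X i a b \<Longrightarrow> F i a = F i b \<Longrightarrow> \<exists>c. (a, b, c) \<in> R i"


section \<open>Weak omega categories and omega pseudo-functors\<close>

record ('a, 'b, 'c) weak_omega_category =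
  magma1 :: "'a omega_magma"
  magma2 :: "'b omega_magma"
  magma3 :: "'c omega_magma"
  lam :: "nat \<Rightarrow> 'b \<Rightarrow> 'a"
  rho :: "nat \<Rightarrow> 'a \<Rightarrow> 'b"
  bridge :: "nat \<Rightarrow> ('b \<times> 'b \<times> 'b) set"
  kap :: "nat \<Rightarrow> 'b \<Rightarrow> 'c"

locale weak_omega_category =
  fixes X :: "('a, 'b, 'c) weak_omega_category"
  assumes magma1: "omega_magma (magma1 X)"
    and magma2: "omega_magma (magma2 X)"
    and lam: "omega_magma_morphism (magma2 X) (magma1 X) (lam X)"
    and rho: "omega_graph_morphism (magma1 X) (magma2 X) (rho X)"
    and lam_rho: "x \<in> cells (magma1 X) i \<Longrightarrow> lam X i (rho X i x) = x"
    and bridge: "bridge_relation (magma2 X) (bridge X)"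
    and magma3: "strict_omega_category (magma3 X)"
    and kap: "categorical_penon_morphism (magma2 X) (bridge X)
                (magma3 X) (diagonal_bridge (magma3 X)) (kap X)"

definition weak_skeletal :: "nat \<Rightarrow> ('a, 'b, 'c) weak_omega_category \<Rightarrow> bool" where
  "weak_skeletal n X \<longleftrightarrow> skeletal n (magma1 X)"

locale omega_pseudo_functor = X: weak_omega_category X + Y: weak_omega_category Y
  for X :: "('a, 'b, 'c) weak_omega_category" and Y :: "('d, 'e, 'f) weak_omega_category" +
  fixes F1 :: "nat \<Rightarrow> 'a \<Rightarrow> 'd" and F2 :: "nat \<Rightarrow> 'b \<Rightarrow> 'e" and F3 :: "nat \<Rightarrow> 'c \<Rightarrow> 'f"
  assumes F1: "globular_morphism (magma1 X) (magma1 Y) F1"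
    and F2: "globular_morphism (magma2 X) (magma2 Y) F2"
    and F3: "omega_graph_morphism (magma3 X) (magma3 Y) F3"
    and F_lam: "x \<in> cells (magma2 X) i \<Longrightarrow> F1 i (lam X i x) = lam Y i (F2 i x)"
    and F_kap: "x \<in> cells (magma2 X) i \<Longrightarrow> F3 i (kap X i x) = kap Y i (F2 i x)"
    and F_gcomp: "composable (magma2 X) j (Suc j) a b \<Longrightarrow>
          kap Y (Suc j) (gcomp (magma2 Y) j (Suc j) (F2 (Suc j) a) (F2 (Suc j) b)) =
          kap Y (Suc j) (F2 (Suc j) (gcomp (magma2 X) j (Suc j) a b))"


section \<open>Classical bicategories and their homomorphisms\<close>

text \<open>
  A bicategory is a 2-skeletal omega magma together with its associators and unitors. In a
  2-skeletal omega magma the boundaries force every composite of cells of dimension above 2, so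
  all the data lives in dimensions 0, 1, 2.
\<close>

record 'a bicategory = "'a omega_magma" +
  assoc :: "'a \<Rightarrow> 'a \<Rightarrow> 'a \<Rightarrow> 'a"
  lunit :: "'a \<Rightarrow> 'a"
  runit :: "'a \<Rightarrow> 'a"

abbreviation hcomp1 :: "_ \<Rightarrow> 'a \<Rightarrow> 'a \<Rightarrow> 'a" (infixl "\<odot>\<index>" 75) where
  "f \<odot>\<^bsub>A\<^esub> g \<equiv> gcomp A 0 1 f g"

abbreviation hcomp2 :: "_ \<Rightarrow> 'a \<Rightarrow> 'a \<Rightarrow> 'a" (infixl "\<star>\<index>" 75) where
  "\<alpha> \<star>\<^bsub>A\<^esub> \<beta> \<equiv> gcomp A 0 2 \<alpha> \<beta>"

abbreviation vcomp :: "_ \<Rightarrow> 'a \<Rightarrow> 'a \<Rightarrow> 'a" (infixl "\<cdot>\<index>" 70) where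
  "\<alpha> \<cdot>\<^bsub>A\<^esub> \<beta> \<equiv> gcomp A 1 2 \<alpha> \<beta>"

definition two_cell :: "('a, 'm) globular_set_scheme \<Rightarrow> 'a \<Rightarrow> 'a \<Rightarrow> 'a \<Rightarrow> bool" where
  "two_cell A \<alpha> f g \<longleftrightarrow> \<alpha> \<in> cells A 2 \<and> gdom A 1 \<alpha> = f \<and> gcod A 1 \<alpha> = g"

definition iso_two_cell :: "('a, 'm) omega_magma_scheme \<Rightarrow> 'a \<Rightarrow> 'a \<Rightarrow> 'a \<Rightarrow> bool" where
  "iso_two_cell A \<alpha> f g \<longleftrightarrow> two_cell A \<alpha> f g \<and>
     (\<exists>\<beta>. two_cell A \<beta> g f \<and> \<alpha> \<cdot>\<^bsub>A\<^esub> \<beta> = gid A 1 f \<and> \<beta> \<cdot>\<^bsub>A\<^esub> \<alpha> = gid A 1 g)"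

locale bicategory = omega_magma A for A :: "('a, 'm) bicategory_scheme" (structure) +
  assumes two_skeletal: "skeletal 2 A"
    and vcomp_assoc: "composable A 1 2 \<alpha> \<beta> \<Longrightarrow> composable A 1 2 \<beta> \<gamma> \<Longrightarrow>
          (\<alpha> \<cdot> \<beta>) \<cdot> \<gamma> = \<alpha> \<cdot> (\<beta> \<cdot> \<gamma>)"
    and vcomp_id_left: "two_cell A \<alpha> f g \<Longrightarrow> gid A 1 f \<cdot> \<alpha> = \<alpha>"
    and vcomp_id_right: "two_cell A \<alpha> f g \<Longrightarrow> \<alpha> \<cdot> gid A 1 g = \<alpha>"
    and hcomp_vcomp: "composable A 1 2 \<alpha> \<beta> \<Longrightarrow> composable A 1 2 \<gamma> \<delta> \<Longrightarrow>
          composable A 0 2 (\<alpha> \<cdot> \<beta>) (\<gamma> \<cdot> \<delta>) \<Longrightarrow>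
          (\<alpha> \<cdot> \<beta>) \<star> (\<gamma> \<cdot> \<delta>) = (\<alpha> \<star> \<gamma>) \<cdot> (\<beta> \<star> \<delta>)"
    and hcomp_id: "composable A 0 1 f g \<Longrightarrow> gid A 1 f \<star> gid A 1 g = gid A 1 (f \<odot> g)"
    and assoc_iso: "composable A 0 1 f g \<Longrightarrow> composable A 0 1 g k \<Longrightarrow>
          iso_two_cell A (assoc A f g k) ((f \<odot> g) \<odot> k) (f \<odot> (g \<odot> k))"
    and lunit_iso: "f \<in> cells A 1 \<Longrightarrow>
          iso_two_cell A (lunit A f) (gid A 0 (gdom A 0 f) \<odot> f) f"
    and runit_iso: "f \<in> cells A 1 \<Longrightarrow>
          iso_two_cell A (runit A f) (f \<odot> gid A 0 (gcod A 0 f)) f"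
    and assoc_natural: "two_cell A \<alpha> f f' \<Longrightarrow> two_cell A \<beta> g g' \<Longrightarrow> two_cell A \<gamma> k k' \<Longrightarrow>
          composable A 0 1 f g \<Longrightarrow> composable A 0 1 g k \<Longrightarrow>
          ((\<alpha> \<star> \<beta>) \<star> \<gamma>) \<cdot> assoc A f' g' k' = assoc A f g k \<cdot> (\<alpha> \<star> (\<beta> \<star> \<gamma>))"
    and lunit_natural: "two_cell A \<alpha> f f' \<Longrightarrow>
          (gid A 1 (gid A 0 (gdom A 0 f)) \<star> \<alpha>) \<cdot> lunit A f' = lunit A f \<cdot> \<alpha>"
    and runit_natural: "two_cell A \<alpha> f f' \<Longrightarrow>
          (\<alpha> \<star> gid A 1 (gid A 0 (gcod A 0 f))) \<cdot> runit A f' = runit A f \<cdot> \<alpha>"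
    and pentagon: "composable A 0 1 e f \<Longrightarrow> composable A 0 1 f g \<Longrightarrow> composable A 0 1 g k \<Longrightarrow>
          (assoc A e f g \<star> gid A 1 k) \<cdot> assoc A e (f \<odot> g) k \<cdot> (gid A 1 e \<star> assoc A f g k) =
          assoc A (e \<odot> f) g k \<cdot> assoc A e f (g \<odot> k)"
    and triangle: "composable A 0 1 f g \<Longrightarrow>
          assoc A f (gid A 0 (gcod A 0 f)) g \<cdot> (gid A 1 f \<star> lunit A g) = runit A f \<star> gid A 1 g"

text \<open>
  A homomorphism is given as a map of the globular sets underlying the two omega magmas. Since the
  target is 2-skeletal, compatibility with boundaries determines it above dimension 2.
\<close>

locale homomorphism = A: bicategory A + B: bicategory B + globular_morphism A B h
  for A :: "('a, 'm) bicategory_scheme" and B :: "('b, 'n) bicategory_scheme"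
    and h :: "nat \<Rightarrow> 'a \<Rightarrow> 'b" +
  fixes \<phi> :: "'a \<Rightarrow> 'a \<Rightarrow> 'b" and \<phi>0 :: "'a \<Rightarrow> 'b"
  assumes hom_vcomp: "composable A 1 2 \<alpha> \<beta> \<Longrightarrow> h 2 (\<alpha> \<cdot>\<^bsub>A\<^esub> \<beta>) = h 2 \<alpha> \<cdot>\<^bsub>B\<^esub> h 2 \<beta>"
    and hom_id: "f \<in> cells A 1 \<Longrightarrow> h 2 (gid A 1 f) = gid B 1 (h 1 f)"
    and \<phi>_iso: "composable A 0 1 f g \<Longrightarrow>
          iso_two_cell B (\<phi> f g) (h 1 f \<odot>\<^bsub>B\<^esub> h 1 g) (h 1 (f \<odot>\<^bsub>A\<^esub> g))"
    and \<phi>0_iso: "a \<in> cells A 0 \<Longrightarrow>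
          iso_two_cell B (\<phi>0 a) (gid B 0 (h 0 a)) (h 1 (gid A 0 a))"
    and \<phi>_natural: "two_cell A \<alpha> f f' \<Longrightarrow> two_cell A \<beta> g g' \<Longrightarrow> composable A 0 1 f g \<Longrightarrow>
          (h 2 \<alpha> \<star>\<^bsub>B\<^esub> h 2 \<beta>) \<cdot>\<^bsub>B\<^esub> \<phi> f' g' = \<phi> f g \<cdot>\<^bsub>B\<^esub> h 2 (\<alpha> \<star>\<^bsub>A\<^esub> \<beta>)"
    and \<phi>_assoc: "composable A 0 1 f g \<Longrightarrow> composable A 0 1 g k \<Longrightarrow>
          (\<phi> f g \<star>\<^bsub>B\<^esub> gid B 1 (h 1 k)) \<cdot>\<^bsub>B\<^esub> \<phi> (f \<odot>\<^bsub>A\<^esub> g) k \<cdot>\<^bsub>B\<^esub> h 2 (assoc A f g k) =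
          assoc B (h 1 f) (h 1 g) (h 1 k) \<cdot>\<^bsub>B\<^esub> (gid B 1 (h 1 f) \<star>\<^bsub>B\<^esub> \<phi> g k) \<cdot>\<^bsub>B\<^esub> \<phi> f (g \<odot>\<^bsub>A\<^esub> k)"
    and \<phi>_lunit: "f \<in> cells A 1 \<Longrightarrow>
          (\<phi>0 (gdom A 0 f) \<star>\<^bsub>B\<^esub> gid B 1 (h 1 f)) \<cdot>\<^bsub>B\<^esub> \<phi> (gid A 0 (gdom A 0 f)) f \<cdot>\<^bsub>B\<^esub> h 2 (lunit A f) =
          lunit B (h 1 f)"
    and \<phi>_runit: "f \<in> cells A 1 \<Longrightarrow>
          (gid B 1 (h 1 f) \<star>\<^bsub>B\<^esub> \<phi>0 (gcod A 0 f)) \<cdot>\<^bsub>B\<^esub> \<phi> f (gid A 0 (gcod A 0 f)) \<cdot>\<^bsub>B\<^esub> h 2 (runit A f) =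
          runit B (h 1 f)"

definition proper ::
    "('a, 'm) bicategory_scheme \<Rightarrow> ('b, 'n) bicategory_scheme \<Rightarrow> (nat \<Rightarrow> 'a \<Rightarrow> 'b) \<Rightarrow>
     ('a \<Rightarrow> 'a \<Rightarrow> 'b) \<Rightarrow> ('a \<Rightarrow> 'b) \<Rightarrow> bool" where
  "proper A B h \<phi> \<phi>0 \<longleftrightarrow>
     (\<forall>f g. composable A 0 1 f g \<longrightarrow> h 1 f \<odot>\<^bsub>B\<^esub> h 1 g = h 1 (f \<odot>\<^bsub>A\<^esub> g) \<longrightarrow>
        \<phi> f g = gid B 1 (h 1 (f \<odot>\<^bsub>A\<^esub> g))) \<and>
     (\<forall>a\<in>cells A 0. gid B 0 (h 0 a) = h 1 (gid A 0 a) \<longrightarrow>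
        \<phi>0 a = gid B 1 (h 1 (gid A 0 a))) \<and>
     (\<forall>f f' g g'. composable A 0 1 f g \<longrightarrow> composable A 0 1 f' g' \<longrightarrow>
        f \<odot>\<^bsub>A\<^esub> g = f' \<odot>\<^bsub>A\<^esub> g' \<longrightarrow> h 1 f \<odot>\<^bsub>B\<^esub> h 1 g = h 1 f' \<odot>\<^bsub>B\<^esub> h 1 g' \<longrightarrow>
        \<phi> f g = \<phi> f' g') \<and>
     (\<forall>a\<in>cells A 0. \<forall>b\<in>cells A 0. h 0 a = h 0 b \<longrightarrow> h 1 (gid A 0 a) = h 1 (gid A 0 b) \<longrightarrow>
        \<phi>0 a = \<phi>0 b)"


section \<open>A type for auxiliary cells\<close>

text \<open>
  HOL cannot quantify existentially over types, so existence of weak omega categories needs a fixed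
  type for the cells of the second and third component. Finitely branching trees labelled by
  \<open>'g\<close> at leaves and by natural numbers at inner nodes form a type of cardinality
  \<open>max(aleph_0, |'g|)\<close>. With \<open>'g = 'a + 'b\<close> this loses no generality: if \<open>A\<close> and \<open>B\<close> have
  cells in \<open>'a\<close> and \<open>'b\<close>, then in any weak omega categories with first components \<open>A\<close> and
  \<open>B\<close>, and any omega pseudo-functor between them, the second and third components can be cut down
  to the substructures generated by the images of \<open>rho\<close> and of the pseudo-functor, closed under
  boundaries, identities, composites and bridges, and these are no larger.
\<close>

datatype 'g tree = Leaf 'g | Node nat "'g tree list"

end

theory Submission
  imports Defs
begin

text \<open>
  The weak omega category attached to a bicategory \<open>A\<close> is an interpolation between \<open>A\<close> and its
  strictification. A path is a composable list of 1-cells together with its end object; \<open>ev\<close>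
  composes it in \<open>A\<close>, bracketed to the right and ending with an identity. The third component
  has the paths as 1-cells, composed by concatenation, and the 2-cells \<open>ev P \<rightarrow> ev Q\<close> of \<open>A\<close> as
  2-cells from \<open>P\<close> to \<open>Q\<close>. Horizontal composition conjugates the one of \<open>A\<close> by the canonical
  isomorphisms \<open>\<mu>\<close> from \<open>ev p \<odot> ev q\<close> to \<open>ev (p @ q)\<close>, and it is strictly associative and unital
  because \<open>\<mu>\<close> itself satisfies a cocycle identity (\<open>\<mu>_assoc\<close>, from the pentagon) and a unit
  identity (\<open>\<mu>_Nil\<close>, from Kelly's consequences of the triangle). This is the coherence theorem
  for bicategories in the form in which it is used here.

  The second component does not have to be free. Its 1-cells are pairs of a path \<open>P\<close> and an
  invertible 2-cell \<open>\<nu>\<close> of \<open>A\<close> from some 1-cell to \<open>ev P\<close>; the domain of \<open>\<nu>\<close> is the 1-cell of \<open>A\<close>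
  that \<open>\<lambda>\<close> assigns, and \<open>P\<close> is what \<open>\<kappa>\<close> assigns. Its 2-cells are the 2-cells of \<open>A\<close> between the
  domains. Two 1-cells \<open>(P, \<nu>)\<close> and \<open>(P, \<nu>')\<close> over the same path are bridged by \<open>\<nu>\<close> followed by
  the inverse of \<open>\<nu>'\<close>, which \<open>\<kappa>\<close> sends to an identity. On parallel 2-cells \<open>\<kappa>\<close> is conjugation by
  isomorphisms, hence injective, so nothing is left to bridge above dimension 1 and all three
  components can be taken 2-skeletal.

  A homomorphism \<open>h\<close> acts on paths entrywise. Iterating its coherence isomorphisms gives, for each
  path \<open>P\<close>, an invertible comparison \<open>h (ev P) \<rightarrow> ev (h P)\<close>, and \<open>F\<^sub>2\<close> sends \<open>(P, \<nu>)\<close> to \<open>(h P, h \<nu>)\<close>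
  with \<open>h \<nu>\<close> prolonged by the comparison. This lies over \<open>h\<close> by construction, and it is functorial
  after \<open>\<kappa>\<close> because concatenation of paths is preserved exactly. A pseudo-functor only has to
  respect composition along the boundary of codimension one, that is, composition of 1-cells and
  vertical composition of 2-cells; hence any choice of invertible comparisons serves.
\<close>

text \<open>The numeral \<open>1\<close> is kept as it stands, so that \<open>1\<close>-cells and \<open>2\<close>-cells have one normal form.\<close>

declare One_nat_def [simp del]

section \<open>Calculus of cells in a bicategory\<close>

context bicategory
begin

abbreviation "ob a \<equiv> a \<in> cells A 0"
abbreviation "ar f \<equiv> f \<in> cells A 1"
abbreviation "ce \<alpha> \<equiv> \<alpha> \<in> cells A 2"
abbreviation "src f \<equiv> gdom A 0 f"
abbreviation "tgt f \<equiv> gcod A 0 f"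
abbreviation "dm \<alpha> \<equiv> gdom A 1 \<alpha>"
abbreviation "cd \<alpha> \<equiv> gcod A 1 \<alpha>"
abbreviation "U a \<equiv> gid A 0 a"
abbreviation "I f \<equiv> gid A 1 f"

lemma src_tgt_ob [simp]: "ar f \<Longrightarrow> ob (src f)" "ar f \<Longrightarrow> ob (tgt f)"
  using gdom_closed[of f 0] gcod_closed[of f 0] by (simp_all add: One_nat_def)

lemma dm_cd_ar [simp]: "ce \<alpha> \<Longrightarrow> ar (dm \<alpha>)" "ce \<alpha> \<Longrightarrow> ar (cd \<alpha>)"
  using gdom_closed[of \<alpha> 1] gcod_closed[of \<alpha> 1] by (simp_all add: numeral_2_eq_2 One_nat_def)

lemma src_tgt_cd [simp]: "ce \<alpha> \<Longrightarrow> src (cd \<alpha>) = src (dm \<alpha>)" "ce \<alpha> \<Longrightarrow> tgt (cd \<alpha>) = tgt (dm \<alpha>)"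
  using gdom_gdom[of \<alpha> 0] gcod_gdom[of \<alpha> 0] by (simp_all add: numeral_2_eq_2 One_nat_def)

lemma U_simps [simp]: "ob a \<Longrightarrow> ar (U a)" "ob a \<Longrightarrow> src (U a) = a" "ob a \<Longrightarrow> tgt (U a) = a"
  using gid_closed[of a 0] gdom_gid[of a 0] gcod_gid[of a 0] by (simp_all add: One_nat_def)

lemma I_simps [simp]: "ar f \<Longrightarrow> ce (I f)" "ar f \<Longrightarrow> dm (I f) = f" "ar f \<Longrightarrow> cd (I f) = f"
  using gid_closed[of f 1] gdom_gid[of f 1] gcod_gid[of f 1] by (simp_all add: numeral_2_eq_2 One_nat_def)

lemma composable01: "composable A 0 1 f g \<longleftrightarrow> ar f \<and> ar g \<and> tgt f = src g"
  by (simp add: composable_def One_nat_def)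

lemma composable12: "composable A 1 2 \<alpha> \<beta> \<longleftrightarrow> ce \<alpha> \<and> ce \<beta> \<and> cd \<alpha> = dm \<beta>"
  by (simp add: composable_def numeral_2_eq_2 One_nat_def)

lemma composable02: "composable A 0 2 \<alpha> \<beta> \<longleftrightarrow> ce \<alpha> \<and> ce \<beta> \<and> tgt (dm \<alpha>) = src (dm \<beta>)"
  using src_tgt_cd by (auto simp add: composable_def numeral_2_eq_2 One_nat_def)

lemma comp1_simps [simp]:
  assumes "ar f" "ar g" "tgt f = src g"
  shows "ar (f \<odot> g)" "src (f \<odot> g) = src f" "tgt (f \<odot> g) = tgt g"
  using gcomp_closed[of 0 1 f g] gdom_gcomp[of 0 f g] gcod_gcomp[of 0 f g] assms
  unfolding One_nat_def[symmetric] composable01 by auto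

lemma vcomp_simps [simp]:
  assumes "ce \<alpha>" "ce \<beta>" "cd \<alpha> = dm \<beta>"
  shows "ce (\<alpha> \<cdot> \<beta>)" "dm (\<alpha> \<cdot> \<beta>) = dm \<alpha>" "cd (\<alpha> \<cdot> \<beta>) = cd \<beta>"
  using gcomp_closed[of 1 2 \<alpha> \<beta>] gdom_gcomp[of 1 \<alpha> \<beta>] gcod_gcomp[of 1 \<alpha> \<beta>] assms
  unfolding Suc_1 composable12 by auto

lemma hcomp_simps [simp]:
  assumes "ce \<alpha>" "ce \<beta>" "tgt (dm \<alpha>) = src (dm \<beta>)"
  shows "ce (\<alpha> \<star> \<beta>)" "dm (\<alpha> \<star> \<beta>) = dm \<alpha> \<odot> dm \<beta>" "cd (\<alpha> \<star> \<beta>) = cd \<alpha> \<odot> cd \<beta>"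
  using gcomp_closed[of 0 2 \<alpha> \<beta>] gdom_gcomp_less[of 0 1 \<alpha> \<beta>] gcod_gcomp_less[of 0 1 \<alpha> \<beta>] assms
  unfolding Suc_1 composable02 by auto

lemma vassoc:
  "ce \<alpha> \<Longrightarrow> ce \<beta> \<Longrightarrow> ce \<gamma> \<Longrightarrow> cd \<alpha> = dm \<beta> \<Longrightarrow> cd \<beta> = dm \<gamma> \<Longrightarrow> (\<alpha> \<cdot> \<beta>) \<cdot> \<gamma> = \<alpha> \<cdot> (\<beta> \<cdot> \<gamma>)"
  using vcomp_assoc by (simp add: composable12)

lemma vid [simp]:
  "ce \<alpha> \<Longrightarrow> dm \<alpha> = f \<Longrightarrow> I f \<cdot> \<alpha> = \<alpha>" "ce \<alpha> \<Longrightarrow> cd \<alpha> = f \<Longrightarrow> \<alpha> \<cdot> I f = \<alpha>"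
  using vcomp_id_left vcomp_id_right by (auto simp: two_cell_def)

lemma hid: "ar f \<Longrightarrow> ar g \<Longrightarrow> tgt f = src g \<Longrightarrow> I f \<star> I g = I (f \<odot> g)"
  using hcomp_id by (simp add: composable01)

lemma exchange:
  assumes "ce \<alpha>" "ce \<beta>" "ce \<gamma>" "ce \<delta>" "cd \<alpha> = dm \<beta>" "cd \<gamma> = dm \<delta>" "tgt (dm \<alpha>) = src (dm \<gamma>)"
  shows "(\<alpha> \<cdot> \<beta>) \<star> (\<gamma> \<cdot> \<delta>) = (\<alpha> \<star> \<gamma>) \<cdot> (\<beta> \<star> \<delta>)"
  using hcomp_vcomp assms by (simp add: composable12 composable02)

definition inverses where
  "inverses \<alpha> \<beta> \<longleftrightarrow> ce \<alpha> \<and> ce \<beta> \<and> dm \<beta> = cd \<alpha> \<and> cd \<beta> = dm \<alpha> \<and> \<alpha> \<cdot> \<beta> = I (dm \<alpha>) \<and> \<beta> \<cdot> \<alpha> = I (cd \<alpha>)"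

definition isoc where "isoc \<alpha> \<longleftrightarrow> (\<exists>\<beta>. inverses \<alpha> \<beta>)"

definition vinv where "vinv \<alpha> = (SOME \<beta>. inverses \<alpha> \<beta>)"

lemma isoc_iff: "iso_two_cell A \<alpha> f g \<longleftrightarrow> isoc \<alpha> \<and> dm \<alpha> = f \<and> cd \<alpha> = g"
  by (auto simp: iso_two_cell_def two_cell_def isoc_def inverses_def)

lemma inverses_vinv: "isoc \<alpha> \<Longrightarrow> inverses \<alpha> (vinv \<alpha>)"
  unfolding isoc_def vinv_def by (rule someI_ex)

lemma vinv_simps [simp]:
  assumes "isoc \<alpha>"
  shows "ce \<alpha>" "ce (vinv \<alpha>)" "dm (vinv \<alpha>) = cd \<alpha>" "cd (vinv \<alpha>) = dm \<alpha>"
    "\<alpha> \<cdot> vinv \<alpha> = I (dm \<alpha>)" "vinv \<alpha> \<cdot> \<alpha> = I (cd \<alpha>)"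
  using inverses_vinv[OF assms] by (auto simp: inverses_def)

lemma vinv_vcomp [simp]:
  assumes "isoc \<alpha>" "ce \<beta>"
  shows "dm \<beta> = cd \<alpha> \<Longrightarrow> vinv \<alpha> \<cdot> (\<alpha> \<cdot> \<beta>) = \<beta>" "dm \<beta> = dm \<alpha> \<Longrightarrow> \<alpha> \<cdot> (vinv \<alpha> \<cdot> \<beta>) = \<beta>"
  using assms by (simp_all flip: vassoc)

lemma vcancel_left:
  assumes "\<alpha> \<cdot> \<beta> = \<alpha> \<cdot> \<gamma>" "isoc \<alpha>" "ce \<beta>" "ce \<gamma>" "dm \<beta> = cd \<alpha>" "dm \<gamma> = cd \<alpha>"
  shows "\<beta> = \<gamma>"
  using assms vinv_vcomp(1) by metis

lemma vcancel_right:
  assumes "\<beta> \<cdot> \<alpha> = \<gamma> \<cdot> \<alpha>" "isoc \<alpha>" "ce \<beta>" "ce \<gamma>" "cd \<beta> = dm \<alpha>" "cd \<gamma> = dm \<alpha>"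
  shows "\<beta> = \<gamma>"
proof -
  have "(\<beta> \<cdot> \<alpha>) \<cdot> vinv \<alpha> = (\<gamma> \<cdot> \<alpha>) \<cdot> vinv \<alpha>" by (simp only: assms(1))
  then show ?thesis using assms(2-) by (simp add: vassoc)
qed

lemma inverses_unique:
  assumes "inverses \<alpha> \<beta>" "inverses \<alpha> \<gamma>" shows "\<beta> = \<gamma>"
proof (rule vcancel_left[of \<alpha>])
  show "isoc \<alpha>" using assms isoc_def by blast
qed (use assms in \<open>simp_all add: inverses_def\<close>)

lemma vinv_eqI: "inverses \<alpha> \<beta> \<Longrightarrow> vinv \<alpha> = \<beta>"
  using inverses_unique inverses_vinv isoc_def by blast

lemma inverses_I: "ar f \<Longrightarrow> inverses (I f) (I f)"
  by (simp add: inverses_def)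

lemma inversesD:
  assumes "inverses \<alpha> \<beta>"
  shows "ce \<alpha>" "ce \<beta>" "dm \<beta> = cd \<alpha>" "cd \<beta> = dm \<alpha>"
    and "\<alpha> \<cdot> \<beta> = I (dm \<alpha>)" "\<beta> \<cdot> \<alpha> = I (cd \<alpha>)"
  using assms by (simp_all add: inverses_def)

lemma inverses_vcomp:
  assumes "inverses \<alpha> \<alpha>'" "inverses \<beta> \<beta>'" "cd \<alpha> = dm \<beta>"
  shows "inverses (\<alpha> \<cdot> \<beta>) (\<beta>' \<cdot> \<alpha>')"
proof -
  note c = inversesD(1-4)[OF assms(1)] inversesD(1-4)[OF assms(2)] assms(3)
    and e = inversesD(5,6)[OF assms(1)] inversesD(5,6)[OF assms(2)]
  have *: "(\<alpha> \<cdot> \<beta>) \<cdot> (\<beta>' \<cdot> \<alpha>') = \<alpha> \<cdot> ((\<beta> \<cdot> \<beta>') \<cdot> \<alpha>')" "(\<beta>' \<cdot> \<alpha>') \<cdot> (\<alpha> \<cdot> \<beta>) = \<beta>' \<cdot> ((\<alpha>' \<cdot> \<alpha>) \<cdot> \<beta>)"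
    using c by (simp_all add: vassoc)
  show ?thesis
    unfolding inverses_def * using c by (simp add: e)
qed

lemma inverses_hcomp:
  assumes "inverses \<alpha> \<alpha>'" "inverses \<beta> \<beta>'" "tgt (dm \<alpha>) = src (dm \<beta>)"
  shows "inverses (\<alpha> \<star> \<beta>) (\<alpha>' \<star> \<beta>')"
proof -
  note c = inversesD(1-4)[OF assms(1)] inversesD(1-4)[OF assms(2)] assms(3)
    and e = inversesD(5,6)[OF assms(1)] inversesD(5,6)[OF assms(2)]
  have *: "(\<alpha> \<star> \<beta>) \<cdot> (\<alpha>' \<star> \<beta>') = (\<alpha> \<cdot> \<alpha>') \<star> (\<beta> \<cdot> \<beta>')" "(\<alpha>' \<star> \<beta>') \<cdot> (\<alpha> \<star> \<beta>) = (\<alpha>' \<cdot> \<alpha>) \<star> (\<beta>' \<cdot> \<beta>)"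
    using c by (simp_all add: exchange)
  show ?thesis
    unfolding inverses_def * using c by (simp add: e hid)
qed

lemma isoc_I [simp]: "ar f \<Longrightarrow> isoc (I f)"
  and vinv_I [simp]: "ar f \<Longrightarrow> vinv (I f) = I f"
  using inverses_I vinv_eqI isoc_def by blast+

lemma isoc_vinv [simp]: "isoc \<alpha> \<Longrightarrow> isoc (vinv \<alpha>)"
  using inverses_vinv unfolding isoc_def inverses_def by fastforce

lemma
  assumes "isoc \<alpha>" "isoc \<beta>" "cd \<alpha> = dm \<beta>"
  shows isoc_vcomp [simp]: "isoc (\<alpha> \<cdot> \<beta>)"
    and vinv_of_vcomp: "vinv (\<alpha> \<cdot> \<beta>) = vinv \<beta> \<cdot> vinv \<alpha>"
  using inverses_vcomp[OF assms(1,2)[THEN inverses_vinv] assms(3)] vinv_eqI isoc_def by blast+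

lemma
  assumes "isoc \<alpha>" "isoc \<beta>" "tgt (dm \<alpha>) = src (dm \<beta>)"
  shows isoc_hcomp [simp]: "isoc (\<alpha> \<star> \<beta>)"
    and vinv_of_hcomp: "vinv (\<alpha> \<star> \<beta>) = vinv \<alpha> \<star> vinv \<beta>"
  using inverses_hcomp[OF assms(1,2)[THEN inverses_vinv] assms(3)] vinv_eqI isoc_def by blast+

lemma assoc_simps [simp]:
  assumes "ar f" "ar g" "ar k" "tgt f = src g" "tgt g = src k"
  shows "isoc (assoc A f g k)" "dm (assoc A f g k) = (f \<odot> g) \<odot> k" "cd (assoc A f g k) = f \<odot> (g \<odot> k)"
  using assoc_iso[of f g k] assms by (auto simp: isoc_iff composable01)

lemma lunit_simps [simp]:
  assumes "ar f" shows "isoc (lunit A f)" "dm (lunit A f) = U (src f) \<odot> f" "cd (lunit A f) = f"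
  using lunit_iso[of f] assms by (auto simp: isoc_iff)

lemma runit_simps [simp]:
  assumes "ar f" shows "isoc (runit A f)" "dm (runit A f) = f \<odot> U (tgt f)" "cd (runit A f) = f"
  using runit_iso[of f] assms by (auto simp: isoc_iff)

lemma iso_ce [simp]:
  shows "ar f \<Longrightarrow> ce (lunit A f)" "ar f \<Longrightarrow> ce (runit A f)"
    "ar f \<Longrightarrow> ar g \<Longrightarrow> ar k \<Longrightarrow> tgt f = src g \<Longrightarrow> tgt g = src k \<Longrightarrow> ce (assoc A f g k)"
  by (rule vinv_simps(1), simp)+

lemma whisker_left:
  assumes "ce \<alpha>" "ce \<beta>" "cd \<alpha> = dm \<beta>" "ar f" "tgt f = src (dm \<alpha>)"
  shows "I f \<star> (\<alpha> \<cdot> \<beta>) = (I f \<star> \<alpha>) \<cdot> (I f \<star> \<beta>)"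
  using exchange[of "I f" "I f" \<alpha> \<beta>] assms by simp

lemma whisker_right:
  assumes "ce \<alpha>" "ce \<beta>" "cd \<alpha> = dm \<beta>" "ar f" "tgt (dm \<alpha>) = src f"
  shows "(\<alpha> \<cdot> \<beta>) \<star> I f = (\<alpha> \<star> I f) \<cdot> (\<beta> \<star> I f)"
  using exchange[of \<alpha> \<beta> "I f" "I f"] assms by simp

lemma assoc_nat:
  assumes "ce \<alpha>" "ce \<beta>" "ce \<gamma>" "tgt (dm \<alpha>) = src (dm \<beta>)" "tgt (dm \<beta>) = src (dm \<gamma>)"
  shows "((\<alpha> \<star> \<beta>) \<star> \<gamma>) \<cdot> assoc A (cd \<alpha>) (cd \<beta>) (cd \<gamma>)
    = assoc A (dm \<alpha>) (dm \<beta>) (dm \<gamma>) \<cdot> (\<alpha> \<star> (\<beta> \<star> \<gamma>))"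
  using assoc_natural[of \<alpha> "dm \<alpha>" "cd \<alpha>" \<beta> "dm \<beta>" "cd \<beta>" \<gamma> "dm \<gamma>" "cd \<gamma>"] assms
  by (simp add: two_cell_def composable01)

lemma lunit_nat:
  "ce \<alpha> \<Longrightarrow> (I (U (src (dm \<alpha>))) \<star> \<alpha>) \<cdot> lunit A (cd \<alpha>) = lunit A (dm \<alpha>) \<cdot> \<alpha>"
  using lunit_natural[of \<alpha> "dm \<alpha>" "cd \<alpha>"] by (simp add: two_cell_def)

lemma runit_nat:
  "ce \<alpha> \<Longrightarrow> (\<alpha> \<star> I (U (tgt (dm \<alpha>)))) \<cdot> runit A (cd \<alpha>) = runit A (dm \<alpha>) \<cdot> \<alpha>"
  using runit_natural[of \<alpha> "dm \<alpha>" "cd \<alpha>"] by (simp add: two_cell_def)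

end

section \<open>Unit coherence\<close>

context bicategory
begin

text \<open>
  Whiskering with an identity 1-cell is faithful, because naturality of the unitor conjugates it
  into the identity functor. The unit coherence laws below are all obtained by proving them after
  such a whiskering and cancelling it.
\<close>

lemma left_unit_faithful:
  assumes "I (U (src (dm \<alpha>))) \<star> \<alpha> = I (U (src (dm \<alpha>))) \<star> \<beta>" "ce \<alpha>" "ce \<beta>" "dm \<alpha> = dm \<beta>" "cd \<alpha> = cd \<beta>"
  shows "\<alpha> = \<beta>"
  by (rule vcancel_left[of "lunit A (dm \<alpha>)"]) (use assms lunit_nat[of \<alpha>] lunit_nat[of \<beta>] in auto)

lemma right_unit_faithful:
  assumes "\<alpha> \<star> I (U (tgt (dm \<alpha>))) = \<beta> \<star> I (U (tgt (dm \<alpha>)))" "ce \<alpha>" "ce \<beta>" "dm \<alpha> = dm \<beta>" "cd \<alpha> = cd \<beta>"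
  shows "\<alpha> = \<beta>"
  by (rule vcancel_left[of "runit A (dm \<alpha>)"]) (use assms runit_nat[of \<alpha>] runit_nat[of \<beta>] in auto)

lemma triangle_law:
  "ar f \<Longrightarrow> ar g \<Longrightarrow> tgt f = src g \<Longrightarrow> U (src g) = u \<Longrightarrow>
    assoc A f u g \<cdot> (I f \<star> lunit A g) = runit A f \<star> I g"
  using triangle[of f g] by (auto simp: composable01)

lemma pentagon_law:
  assumes "ar e" "ar f" "ar g" "ar k" "tgt e = src f" "tgt f = src g" "tgt g = src k"
  shows "(assoc A e f g \<star> I k) \<cdot> (assoc A e (f \<odot> g) k \<cdot> (I e \<star> assoc A f g k))
    = assoc A (e \<odot> f) g k \<cdot> assoc A e f (g \<odot> k)"
  using pentagon[of e f g k] assms by (simp add: composable01 vassoc)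

text \<open>
  Kelly's argument: in the pentagon for \<open>u, u, f, g\<close> with \<open>u\<close> an identity, each side is
  postcomposed with \<open>u\<close> whiskered by a left unitor, and the triangle axiom turns both into
  composites that share an invertible prefix.
\<close>

lemma lunit_comp:
  assumes "ar f" "ar g" "tgt f = src g"
  shows "assoc A (U (src f)) f g \<cdot> lunit A (f \<odot> g) = lunit A f \<star> I g"
proof (rule left_unit_faithful)
  define u where "u = U (src f)"
  have u: "ar u" "src u = src f" "tgt u = src f" "U (src f) = u" using assms by (auto simp: u_def)
  note [simp] = assms u
  \<comment> \<open>the invertible prefix that is cancelled in the end\<close>
  let ?c = "(assoc A u u f \<star> I g) \<cdot> assoc A u (u \<odot> f) g"
  have "?c \<cdot> (I u \<star> (assoc A u f g \<cdot> lunit A (f \<odot> g)))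
      = ((assoc A u u f \<star> I g) \<cdot> (assoc A u (u \<odot> f) g \<cdot> (I u \<star> assoc A u f g))) \<cdot> (I u \<star> lunit A (f \<odot> g))"
    by (simp add: whisker_left vassoc)
  also have "\<dots> = assoc A (u \<odot> u) f g \<cdot> (runit A u \<star> I (f \<odot> g))"
    by (simp add: pentagon_law vassoc triangle_law)
  also have "\<dots> = ((runit A u \<star> I f) \<star> I g) \<cdot> assoc A u f g"
    using assoc_nat[of "runit A u" "I f" "I g"] by (simp add: hid)
  also have "\<dots> = ((assoc A u u f \<cdot> (I u \<star> lunit A f)) \<star> I g) \<cdot> assoc A u f g"
    by (simp add: triangle_law)
  also have "\<dots> = (assoc A u u f \<star> I g) \<cdot> (((I u \<star> lunit A f) \<star> I g) \<cdot> assoc A u f g)"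
    by (simp add: whisker_right vassoc)
  also have "\<dots> = ?c \<cdot> (I u \<star> (lunit A f \<star> I g))"
    using assoc_nat[of "I u" "lunit A f" "I g"] by (simp add: vassoc)
  finally have "?c \<cdot> (I u \<star> (assoc A u f g \<cdot> lunit A (f \<odot> g))) = ?c \<cdot> (I u \<star> (lunit A f \<star> I g))" .
  then have "I u \<star> (assoc A u f g \<cdot> lunit A (f \<odot> g)) = I u \<star> (lunit A f \<star> I g)"
    by (rule vcancel_left) auto
  then show "I (U (src (dm (assoc A (U (src f)) f g \<cdot> lunit A (f \<odot> g))))) \<star> (assoc A (U (src f)) f g \<cdot> lunit A (f \<odot> g)) =
    I (U (src (dm (assoc A (U (src f)) f g \<cdot> lunit A (f \<odot> g))))) \<star> (lunit A f \<star> I g)"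
    by simp
qed (use assms in auto)

text \<open>
  The same argument on the other side, with the pentagon for \<open>f, g, u, u\<close>.
\<close>

lemma runit_comp:
  assumes "ar f" "ar g" "tgt f = src g"
  shows "assoc A f g (U (tgt g)) \<cdot> (I f \<star> runit A g) = runit A (f \<odot> g)"
proof (rule right_unit_faithful)
  define u where "u = U (tgt g)"
  have u: "ar u" "src u = tgt g" "tgt u = tgt g" "U (tgt g) = u" using assms by (auto simp: u_def)
  note [simp] = assms u
  have "((assoc A f g u \<cdot> (I f \<star> runit A g)) \<star> I u) \<cdot> assoc A f g u
      = (assoc A f g u \<star> I u) \<cdot> (((I f \<star> runit A g) \<star> I u) \<cdot> assoc A f g u)"
    by (simp add: whisker_right vassoc)
  also have "\<dots> = (assoc A f g u \<star> I u) \<cdot> (assoc A f (g \<odot> u) u \<cdot> (I f \<star> (runit A g \<star> I u)))"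
    using assoc_nat[of "I f" "runit A g" "I u"] by simp
  also have "\<dots> = (assoc A f g u \<star> I u) \<cdot> (assoc A f (g \<odot> u) u \<cdot> (I f \<star> (assoc A g u u \<cdot> (I g \<star> lunit A u))))"
    by (simp add: triangle_law)
  also have "\<dots> = ((assoc A f g u \<star> I u) \<cdot> (assoc A f (g \<odot> u) u \<cdot> (I f \<star> assoc A g u u))) \<cdot> (I f \<star> (I g \<star> lunit A u))"
    by (simp add: whisker_left vassoc)
  also have "\<dots> = assoc A (f \<odot> g) u u \<cdot> (assoc A f g (u \<odot> u) \<cdot> (I f \<star> (I g \<star> lunit A u)))"
    by (simp add: pentagon_law vassoc)
  also have "\<dots> = assoc A (f \<odot> g) u u \<cdot> ((I (f \<odot> g) \<star> lunit A u) \<cdot> assoc A f g u)"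
    using assoc_nat[of "I f" "I g" "lunit A u"] by (simp add: hid)
  also have "\<dots> = (assoc A (f \<odot> g) u u \<cdot> (I (f \<odot> g) \<star> lunit A u)) \<cdot> assoc A f g u"
    by (simp add: vassoc)
  also have "\<dots> = (runit A (f \<odot> g) \<star> I u) \<cdot> assoc A f g u"
    by (simp add: triangle_law)
  finally have "(assoc A f g u \<cdot> (I f \<star> runit A g)) \<star> I u = runit A (f \<odot> g) \<star> I u"
    by (rule vcancel_right) auto
  then show "(assoc A f g (U (tgt g)) \<cdot> (I f \<star> runit A g)) \<star> I (U (tgt (dm (assoc A f g (U (tgt g)) \<cdot> (I f \<star> runit A g))))) =
    runit A (f \<odot> g) \<star> I (U (tgt (dm (assoc A f g (U (tgt g)) \<cdot> (I f \<star> runit A g)))))"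
    by simp
qed (use assms in auto)

text \<open>
  Both unitors at an identity agree after whiskering: the triangle computes one side and
  \<open>lunit_comp\<close> the other, once the left unitor at \<open>U a \<odot> U a\<close> is recognised as a whiskering.
\<close>

lemma lunit_U:
  assumes "ob a" shows "lunit A (U a) = runit A (U a)"
proof (rule right_unit_faithful)
  note [simp] = assms
  \<comment> \<open>naturality of the left unitor with respect to itself\<close>
  have "lunit A (U a \<odot> U a) = I (U a) \<star> lunit A (U a)"
    by (rule sym, rule vcancel_right[of _ "lunit A (U a)"]) (use lunit_nat[of "lunit A (U a)"] in auto)
  then have "lunit A (U a) \<star> I (U a) = runit A (U a) \<star> I (U a)"
    using lunit_comp[of "U a" "U a"] triangle_law[of "U a" "U a"] by simp
  then show "lunit A (U a) \<star> I (U (tgt (dm (lunit A (U a))))) = runit A (U a) \<star> I (U (tgt (dm (lunit A (U a)))))"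
    by simp
qed (use assms in auto)

end

section \<open>Paths and their evaluation\<close>

context bicategory
begin

text \<open>
  A path is given by its list of 1-cells and its end object \<open>b\<close>. Recording the end instead of the
  start keeps \<open>b\<close> fixed in recursions over the list, and gives the empty path a position.
\<close>

primrec psrc :: "'a list \<Rightarrow> 'a \<Rightarrow> 'a" where
  "psrc [] b = b"
| "psrc (f # p) b = src f"

primrec is_path :: "'a list \<Rightarrow> 'a \<Rightarrow> bool" where
  "is_path [] b \<longleftrightarrow> ob b"
| "is_path (f # p) b \<longleftrightarrow> ar f \<and> tgt f = psrc p b \<and> is_path p b"

primrec ev :: "'a list \<Rightarrow> 'a \<Rightarrow> 'a" where
  "ev [] b = U b"
| "ev (f # p) b = f \<odot> ev p b"

text \<open>
  The canonical isomorphism from \<open>ev p \<odot> ev q\<close> to \<open>ev (p @ q)\<close>, where \<open>p\<close> ends at the start of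
  the path \<open>q\<close> and \<open>q\<close> ends at \<open>c\<close>.
\<close>

primrec \<mu> :: "'a list \<Rightarrow> 'a list \<Rightarrow> 'a \<Rightarrow> 'a" where
  "\<mu> [] q c = lunit A (ev q c)"
| "\<mu> (f # p) q c = assoc A f (ev p (psrc q c)) (ev q c) \<cdot> (I f \<star> \<mu> p q c)"

lemma ev_simps [simp]:
  assumes "is_path p b"
  shows "ar (ev p b)" "src (ev p b) = psrc p b" "tgt (ev p b) = b"
proof -
  have "ar (ev p b) \<and> src (ev p b) = psrc p b \<and> tgt (ev p b) = b"
    using assms by (induction p) auto
  then show "ar (ev p b)" "src (ev p b) = psrc p b" "tgt (ev p b) = b" by auto
qed

lemma path_ends [simp]: "is_path p b \<Longrightarrow> ob b" "is_path p b \<Longrightarrow> ob (psrc p b)"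
  by (induction p) auto

lemma psrc_append [simp]: "psrc (p @ q) c = psrc p (psrc q c)"
  by (cases p) auto

lemma is_path_append [simp]:
  "is_path (p @ q) c \<longleftrightarrow> is_path p (psrc q c) \<and> is_path q c"
  by (induction p) auto

lemma \<mu>_simps [simp]:
  assumes "is_path p (psrc q c)" "is_path q c"
  shows "isoc (\<mu> p q c)" "dm (\<mu> p q c) = ev p (psrc q c) \<odot> ev q c" "cd (\<mu> p q c) = ev (p @ q) c"
proof -
  have "isoc (\<mu> p q c) \<and> dm (\<mu> p q c) = ev p (psrc q c) \<odot> ev q c \<and> cd (\<mu> p q c) = ev (p @ q) c"
    using assms by (induction p) auto
  then show "isoc (\<mu> p q c)" "dm (\<mu> p q c) = ev p (psrc q c) \<odot> ev q c" "cd (\<mu> p q c) = ev (p @ q) c"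
    by auto
qed

lemma ce_\<mu> [simp]: "is_path p (psrc q c) \<Longrightarrow> is_path q c \<Longrightarrow> ce (\<mu> p q c)"
  by simp

text \<open>
  The right unit law for \<open>\<mu>\<close>; the left one is the first recursion equation.
\<close>

lemma \<mu>_Nil: "is_path p b \<Longrightarrow> \<mu> p [] b = runit A (ev p b)"
proof (induction p)
  case Nil
  then show ?case by (simp add: lunit_U)
next
  case (Cons f p)
  then show ?case using runit_comp[of f "ev p b"] by simp
qed

text \<open>
  The cocycle identity that makes concatenation a strictly associative horizontal composition.
  By induction on the first path: for the empty path it is \<open>lunit_comp\<close> and naturality of the left
  unitor, and a further 1-cell \<open>f\<close> is moved past by the pentagon and naturality of the associator.
\<close>

lemma \<mu>_assoc:
  assumes "is_path p (psrc q (psrc r d))" "is_path q (psrc r d)" "is_path r d"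
  shows "(\<mu> p q (psrc r d) \<star> I (ev r d)) \<cdot> \<mu> (p @ q) r d
    = assoc A (ev p (psrc q (psrc r d))) (ev q (psrc r d)) (ev r d)
      \<cdot> ((I (ev p (psrc q (psrc r d))) \<star> \<mu> q r d) \<cdot> \<mu> p (q @ r) d)"
  using assms(1)
proof (induction p)
  case Nil
  define y z where "y = ev q (psrc r d)" and "z = ev r d"
  have [simp]: "ar y" "ar z" "tgt y = src z" "src y = psrc q (psrc r d)"
    using assms by (auto simp: y_def z_def)
  have n: "(I (U (src y)) \<star> \<mu> q r d) \<cdot> lunit A (ev (q @ r) d) = lunit A (y \<odot> z) \<cdot> \<mu> q r d"
    using lunit_nat[of "\<mu> q r d"] assms by (simp add: y_def z_def)
  have "(lunit A y \<star> I z) \<cdot> \<mu> q r d = assoc A (U (src y)) y z \<cdot> (lunit A (y \<odot> z) \<cdot> \<mu> q r d)"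
    using assms by (simp flip: lunit_comp add: vassoc) (simp add: y_def z_def vassoc)
  then show ?case
    by (simp add: n[simplified] y_def[symmetric] z_def[symmetric])
next
  case (Cons f p)
  define x y z where "x = ev p (psrc q (psrc r d))" and "y = ev q (psrc r d)" and "z = ev r d"
  define m1 m2 m3 m4 where "m1 = \<mu> p q (psrc r d)" and "m2 = \<mu> (p @ q) r d"
    and "m3 = \<mu> q r d" and "m4 = \<mu> p (q @ r) d"
  have [simp]: "ar f" "ar x" "ar y" "ar z" "tgt f = src x" "tgt x = src y" "tgt y = src z"
    using assms Cons.prems by (auto simp: x_def y_def z_def)
  have [simp]: "ce m1" "ce m2" "ce m3" "ce m4"
      "dm m1 = x \<odot> y" "dm m2 = cd m1 \<odot> z" "dm m3 = y \<odot> z" "dm m4 = x \<odot> cd m3"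
    using assms Cons.prems by (auto simp: m1_def m2_def m3_def m4_def x_def y_def z_def)
  have [simp]: "ar (cd m1)" "src (cd m1) = src x" "tgt (cd m1) = src z"
      "ar (cd m3)" "src (cd m3) = src y"
    by simp_all
  have ev: "ev (p @ q) (psrc r d) = cd m1" "ev (q @ r) d = cd m3"
    using assms Cons.prems by (auto simp: m1_def m3_def)
  have IH: "(m1 \<star> I z) \<cdot> m2 = assoc A x y z \<cdot> ((I x \<star> m3) \<cdot> m4)"
    using Cons by (simp add: x_def y_def z_def m1_def m2_def m3_def m4_def)
  \<comment> \<open>the associators are moved to the front, where the pentagon applies\<close>
  have "((assoc A f x y \<cdot> (I f \<star> m1)) \<star> I z) \<cdot> (assoc A f (cd m1) z \<cdot> (I f \<star> m2))
      = (assoc A f x y \<star> I z) \<cdot> ((((I f \<star> m1) \<star> I z) \<cdot> assoc A f (cd m1) z) \<cdot> (I f \<star> m2))"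
    by (simp add: whisker_right vassoc)
  also have "\<dots> = (assoc A f x y \<star> I z) \<cdot> ((assoc A f (x \<odot> y) z \<cdot> (I f \<star> (m1 \<star> I z))) \<cdot> (I f \<star> m2))"
    using assoc_nat[of "I f" m1 "I z"] by simp
  also have "\<dots> = (assoc A f x y \<star> I z) \<cdot> (assoc A f (x \<odot> y) z \<cdot> (I f \<star> ((m1 \<star> I z) \<cdot> m2)))"
    by (simp add: whisker_left vassoc)
  also have "\<dots> = (assoc A f x y \<star> I z) \<cdot> (assoc A f (x \<odot> y) z \<cdot> (I f \<star> (assoc A x y z \<cdot> ((I x \<star> m3) \<cdot> m4))))"
    by (simp add: IH)
  also have "\<dots> = ((assoc A f x y \<star> I z) \<cdot> (assoc A f (x \<odot> y) z \<cdot> (I f \<star> assoc A x y z)))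
      \<cdot> ((I f \<star> (I x \<star> m3)) \<cdot> (I f \<star> m4))"
    by (simp add: whisker_left vassoc)
  also have "\<dots> = assoc A (f \<odot> x) y z \<cdot> ((assoc A f x (y \<odot> z) \<cdot> (I f \<star> (I x \<star> m3))) \<cdot> (I f \<star> m4))"
    by (simp add: pentagon_law vassoc)
  also have "\<dots> = assoc A (f \<odot> x) y z \<cdot> (((I (f \<odot> x) \<star> m3) \<cdot> assoc A f x (cd m3)) \<cdot> (I f \<star> m4))"
    using assoc_nat[of "I f" "I x" m3] by (simp add: hid)
  also have "\<dots> = assoc A (f \<odot> x) y z \<cdot> ((I (f \<odot> x) \<star> m3) \<cdot> (assoc A f x (cd m3) \<cdot> (I f \<star> m4)))"
    by (simp add: vassoc)
  finally show ?case
    by (simp add: ev x_def[symmetric] y_def[symmetric] z_def[symmetric]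
        m1_def[symmetric] m2_def[symmetric] m3_def[symmetric] m4_def[symmetric])
qed

end

section \<open>Omega magmas from two-dimensional data\<close>

text \<open>
  A 2-skeletal omega magma is determined by its cells of dimension at most 2. Keeping these apart
  in three types allows 1-cells and 2-cells to be structured values; \<open>inflate\<close> below puts them into
  a single type along three injections.
\<close>

record ('x, 'y, 'z) two_data =
  obs :: "'x set"
  ars :: "'y set"
  cls :: "'z set"
  s0 :: "'y \<Rightarrow> 'x"
  t0 :: "'y \<Rightarrow> 'x"
  s1 :: "'z \<Rightarrow> 'y"
  t1 :: "'z \<Rightarrow> 'y"
  u0 :: "'x \<Rightarrow> 'y"
  u1 :: "'y \<Rightarrow> 'z"
  cm :: "'y \<Rightarrow> 'y \<Rightarrow> 'y"
  hc :: "'z \<Rightarrow> 'z \<Rightarrow> 'z"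
  vc :: "'z \<Rightarrow> 'z \<Rightarrow> 'z"

locale two_magma =
  fixes T :: "('x, 'y, 'z) two_data"
  assumes ars_closed: "f \<in> ars T \<Longrightarrow> s0 T f \<in> obs T \<and> t0 T f \<in> obs T"
    and cls_closed: "x \<in> cls T \<Longrightarrow> s1 T x \<in> ars T \<and> t1 T x \<in> ars T \<and>
          s0 T (t1 T x) = s0 T (s1 T x) \<and> t0 T (t1 T x) = t0 T (s1 T x)"
    and u0_closed: "a \<in> obs T \<Longrightarrow> u0 T a \<in> ars T \<and> s0 T (u0 T a) = a \<and> t0 T (u0 T a) = a"
    and u1_closed: "f \<in> ars T \<Longrightarrow> u1 T f \<in> cls T \<and> s1 T (u1 T f) = f \<and> t1 T (u1 T f) = f"
    and cm_closed: "f \<in> ars T \<Longrightarrow> g \<in> ars T \<Longrightarrow> t0 T f = s0 T g \<Longrightarrow>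
          cm T f g \<in> ars T \<and> s0 T (cm T f g) = s0 T f \<and> t0 T (cm T f g) = t0 T g"
    and vc_closed: "x \<in> cls T \<Longrightarrow> y \<in> cls T \<Longrightarrow> t1 T x = s1 T y \<Longrightarrow>
          vc T x y \<in> cls T \<and> s1 T (vc T x y) = s1 T x \<and> t1 T (vc T x y) = t1 T y"
    and hc_closed: "x \<in> cls T \<Longrightarrow> y \<in> cls T \<Longrightarrow> t0 T (s1 T x) = s0 T (s1 T y) \<Longrightarrow>
          hc T x y \<in> cls T \<and> s1 T (hc T x y) = cm T (s1 T x) (s1 T y) \<and>
          t1 T (hc T x y) = cm T (t1 T x) (t1 T y)"

locale strict_two_category = two_magma +
  assumes cm_assoc: "f \<in> ars T \<Longrightarrow> g \<in> ars T \<Longrightarrow> k \<in> ars T \<Longrightarrow> t0 T f = s0 T g \<Longrightarrow> t0 T g = s0 T k \<Longrightarrow>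
          cm T (cm T f g) k = cm T f (cm T g k)"
    and cm_unit: "f \<in> ars T \<Longrightarrow> cm T (u0 T (s0 T f)) f = f \<and> cm T f (u0 T (t0 T f)) = f"
    and vc_assoc: "x \<in> cls T \<Longrightarrow> y \<in> cls T \<Longrightarrow> z \<in> cls T \<Longrightarrow> t1 T x = s1 T y \<Longrightarrow> t1 T y = s1 T z \<Longrightarrow>
          vc T (vc T x y) z = vc T x (vc T y z)"
    and vc_unit: "x \<in> cls T \<Longrightarrow> vc T (u1 T (s1 T x)) x = x \<and> vc T x (u1 T (t1 T x)) = x"
    and hc_assoc: "x \<in> cls T \<Longrightarrow> y \<in> cls T \<Longrightarrow> z \<in> cls T \<Longrightarrow>
          t0 T (s1 T x) = s0 T (s1 T y) \<Longrightarrow> t0 T (s1 T y) = s0 T (s1 T z) \<Longrightarrow>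
          hc T (hc T x y) z = hc T x (hc T y z)"
    and hc_unit: "x \<in> cls T \<Longrightarrow> hc T (u1 T (u0 T (s0 T (s1 T x)))) x = x \<and>
          hc T x (u1 T (u0 T (t0 T (s1 T x)))) = x"
    and hc_u1: "f \<in> ars T \<Longrightarrow> g \<in> ars T \<Longrightarrow> t0 T f = s0 T g \<Longrightarrow>
          hc T (u1 T f) (u1 T g) = u1 T (cm T f g)"
    and hc_vc: "x \<in> cls T \<Longrightarrow> y \<in> cls T \<Longrightarrow> z \<in> cls T \<Longrightarrow> w \<in> cls T \<Longrightarrow>
          t1 T x = s1 T y \<Longrightarrow> t1 T z = s1 T w \<Longrightarrow> t0 T (s1 T x) = s0 T (s1 T z) \<Longrightarrow>
          hc T (vc T x y) (vc T z w) = vc T (hc T x z) (hc T y w)"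

definition by_dim :: "'r \<Rightarrow> 'r \<Rightarrow> 'r \<Rightarrow> nat \<Rightarrow> 'r" where
  "by_dim a b c n = (if n = 0 then a else if n = 1 then b else c)"

lemma by_dim_simps [simp]:
  "by_dim a b c 0 = a" "by_dim a b c 1 = b" "by_dim a b c (Suc 0) = b" "by_dim a b c 2 = c"
  "by_dim a b c (Suc (Suc n)) = c"
  by (simp_all add: by_dim_def One_nat_def)

lemma dim_cases:
  obtains "n = 0" | "n = Suc 0" | k where "n = Suc (Suc k)"
  by (metis not0_implies_Suc)

text \<open>
  Cells of dimension above 2 are represented by the 2-cell of which they are iterated identities, so
  all boundary and identity maps there are the identity function. Cells composable along a cell of
  dimension at least 2 are then equal, and the composite is either of them.
\<close>

definition inflate ::
    "('x \<Rightarrow> 't) \<Rightarrow> ('y \<Rightarrow> 't) \<Rightarrow> ('z \<Rightarrow> 't) \<Rightarrow> ('x, 'y, 'z) two_data \<Rightarrow> 't omega_magma" where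
  "inflate e0 e1 e2 T =
    \<lparr> cells = by_dim (e0 ` obs T) (e1 ` ars T) (e2 ` cls T),
      gdom = by_dim (e0 \<circ> s0 T \<circ> inv e1) (e1 \<circ> s1 T \<circ> inv e2) id,
      gcod = by_dim (e0 \<circ> t0 T \<circ> inv e1) (e1 \<circ> t1 T \<circ> inv e2) id,
      gid = by_dim (e1 \<circ> u0 T \<circ> inv e0) (e2 \<circ> u1 T \<circ> inv e1) id,
      gcomp = by_dim
        (by_dim (\<lambda>x y. x) (\<lambda>x y. e1 (cm T (inv e1 x) (inv e1 y))) (\<lambda>x y. e2 (hc T (inv e2 x) (inv e2 y))))
        (\<lambda>j x y. e2 (vc T (inv e2 x) (inv e2 y)))
        (\<lambda>j x y. x) \<rparr>"

lemma inflate_simps [simp]: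
  "cells (inflate e0 e1 e2 T) 0 = e0 ` obs T"
  "cells (inflate e0 e1 e2 T) (Suc 0) = e1 ` ars T"
  "cells (inflate e0 e1 e2 T) (Suc (Suc n)) = e2 ` cls T"
  "gdom (inflate e0 e1 e2 T) 0 = e0 \<circ> s0 T \<circ> inv e1"
  "gdom (inflate e0 e1 e2 T) (Suc 0) = e1 \<circ> s1 T \<circ> inv e2"
  "gdom (inflate e0 e1 e2 T) (Suc (Suc n)) = id"
  "gcod (inflate e0 e1 e2 T) 0 = e0 \<circ> t0 T \<circ> inv e1"
  "gcod (inflate e0 e1 e2 T) (Suc 0) = e1 \<circ> t1 T \<circ> inv e2"
  "gcod (inflate e0 e1 e2 T) (Suc (Suc n)) = id"
  "gid (inflate e0 e1 e2 T) 0 = e1 \<circ> u0 T \<circ> inv e0"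
  "gid (inflate e0 e1 e2 T) (Suc 0) = e2 \<circ> u1 T \<circ> inv e1"
  "gid (inflate e0 e1 e2 T) (Suc (Suc n)) = id"
  "gcomp (inflate e0 e1 e2 T) 0 (Suc 0) x y = e1 (cm T (inv e1 x) (inv e1 y))"
  "gcomp (inflate e0 e1 e2 T) 0 (Suc (Suc n)) x y = e2 (hc T (inv e2 x) (inv e2 y))"
  "gcomp (inflate e0 e1 e2 T) (Suc 0) j x y = e2 (vc T (inv e2 x) (inv e2 y))"
  "gcomp (inflate e0 e1 e2 T) (Suc (Suc n)) j x y = x"
  by (simp_all add: inflate_def)

locale encoding =
  fixes e0 :: "'x \<Rightarrow> 't" and e1 :: "'y \<Rightarrow> 't" and e2 :: "'z \<Rightarrow> 't"
  assumes inj0 [simp]: "inj e0" and inj1 [simp]: "inj e1" and inj2 [simp]: "inj e2"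
begin

lemma e_eq_iff [simp]:
  "e0 x = e0 x' \<longleftrightarrow> x = x'" "e1 y = e1 y' \<longleftrightarrow> y = y'" "e2 z = e2 z' \<longleftrightarrow> z = z'"
  by (simp_all add: inj_eq)

lemma mem_iff [simp]:
  "e0 x \<in> e0 ` S0 \<longleftrightarrow> x \<in> S0" "e1 y \<in> e1 ` S1 \<longleftrightarrow> y \<in> S1" "e2 z \<in> e2 ` S2 \<longleftrightarrow> z \<in> S2"
  by (simp_all add: inj_image_mem_iff)

abbreviation "infl T \<equiv> inflate e0 e1 e2 T"

lemma it_inflate:
  "dom_it (infl T) i (Suc (Suc n)) (e2 z) = by_dim (e0 (s0 T (s1 T z))) (e1 (s1 T z)) (e2 z) i"
  "cod_it (infl T) i (Suc (Suc n)) (e2 z) = by_dim (e0 (t0 T (t1 T z))) (e1 (t1 T z)) (e2 z) i"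
  by (induction n) (auto simp: by_dim_def One_nat_def)

lemma it_inflate1:
  "dom_it (infl T) 0 (Suc 0) (e1 f) = e0 (s0 T f)"
  "cod_it (infl T) 0 (Suc 0) (e1 f) = e0 (t0 T f)"
  "id_it (infl T) 0 (Suc 0) (e0 a) = e1 (u0 T a)"
  by simp_all

lemma id_it_inflate:
  "id_it (infl T) 0 (Suc (Suc n)) (e0 a) = e2 (u1 T (u0 T a))"
  "id_it (infl T) (Suc 0) (Suc (Suc n)) (e1 f) = e2 (u1 T f)"
  "id_it (infl T) (Suc (Suc k)) (Suc (Suc n)) x = x"
  by (induction n) simp_all

lemma composable_inflate:
  "composable (infl T) 0 (Suc 0) x y \<longleftrightarrow> (\<exists>f\<in>ars T. \<exists>g\<in>ars T. x = e1 f \<and> y = e1 g \<and> t0 T f = s0 T g)"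
  "composable (infl T) 0 (Suc (Suc n)) x y \<longleftrightarrow>
    (\<exists>f\<in>cls T. \<exists>g\<in>cls T. x = e2 f \<and> y = e2 g \<and> t0 T (t1 T f) = s0 T (s1 T g))"
  "composable (infl T) (Suc 0) (Suc (Suc n)) x y \<longleftrightarrow>
    (\<exists>f\<in>cls T. \<exists>g\<in>cls T. x = e2 f \<and> y = e2 g \<and> t1 T f = s1 T g)"
  "composable (infl T) (Suc (Suc k)) (Suc (Suc n)) x y \<longleftrightarrow> k < n \<and> (\<exists>f\<in>cls T. x = e2 f \<and> y = e2 f)"
  by (auto simp: composable_def it_inflate simp del: dom_it.simps cod_it.simps)
     (auto simp: it_inflate1 simp del: dom_it.simps cod_it.simps)

lemma composable_dims:
  assumes "composable (infl T) i j x y"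
  obtains "i = 0" "j = Suc 0" | n where "i = 0" "j = Suc (Suc n)"
    | n where "i = Suc 0" "j = Suc (Suc n)" | k n where "i = Suc (Suc k)" "j = Suc (Suc n)"
proof -
  have "i < j" using assms by (simp add: composable_def)
  then show ?thesis using that
    by (cases i rule: dim_cases; cases j rule: dim_cases) auto
qed

lemma omega_magma_inflate:
  assumes "two_magma T"
  shows "omega_magma (infl T)"
proof -
  interpret two_magma T by fact
  note cl = ars_closed cls_closed u0_closed u1_closed cm_closed vc_closed hc_closed
  show ?thesis
  proof
    fix x i assume "x \<in> cells (infl T) (Suc i)"
    then show "gdom (infl T) i x \<in> cells (infl T) i" "gcod (infl T) i x \<in> cells (infl T) i"
      by (cases i rule: dim_cases; auto simp: cl)+
  next
    fix x i assume "x \<in> cells (infl T) (Suc (Suc i))"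
    then show "gdom (infl T) i (gdom (infl T) (Suc i) x) = gdom (infl T) i (gcod (infl T) (Suc i) x)"
      "gcod (infl T) i (gdom (infl T) (Suc i) x) = gcod (infl T) i (gcod (infl T) (Suc i) x)"
      by (cases i rule: dim_cases; auto simp: cl)+
  next
    fix x i assume "x \<in> cells (infl T) i"
    then show "gid (infl T) i x \<in> cells (infl T) (Suc i)" "gdom (infl T) i (gid (infl T) i x) = x"
      "gcod (infl T) i (gid (infl T) i x) = x"
      by (cases i rule: dim_cases; auto simp: cl)+
  next
    fix i j x y assume "composable (infl T) i j x y"
    then show "gcomp (infl T) i j x y \<in> cells (infl T) j"
      by (cases rule: composable_dims; auto simp: composable_inflate cl)
  next
    fix i x y assume "composable (infl T) i (Suc i) x y"
    then show "gdom (infl T) i (gcomp (infl T) i (Suc i) x y) = gdom (infl T) i x"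
      "gcod (infl T) i (gcomp (infl T) i (Suc i) x y) = gcod (infl T) i y"
      by (cases i rule: dim_cases; auto simp: composable_inflate cl)+
  next
    fix i j x y assume "i < j" "composable (infl T) i (Suc j) x y"
    then show "gdom (infl T) j (gcomp (infl T) i (Suc j) x y) = gcomp (infl T) i j (gdom (infl T) j x) (gdom (infl T) j y)"
      "gcod (infl T) j (gcomp (infl T) i (Suc j) x y) = gcomp (infl T) i j (gcod (infl T) j x) (gcod (infl T) j y)"
      by (cases i rule: dim_cases; cases j rule: dim_cases; auto simp: composable_inflate cl)+
  qed
qed

lemma strict_omega_category_inflate:
  assumes "strict_two_category T"
  shows "strict_omega_category (infl T)"
proof -
  interpret strict_two_category T by fact
  interpret omega_magma "infl T" by (rule omega_magma_inflate) unfold_locales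
  note cl = ars_closed cls_closed u0_closed u1_closed cm_closed vc_closed hc_closed
  show ?thesis
  proof
    fix i j x y z assume "composable (infl T) i j x y" "composable (infl T) i j y z"
    then show "gcomp (infl T) i j (gcomp (infl T) i j x y) z = gcomp (infl T) i j x (gcomp (infl T) i j y z)"
      by (cases rule: composable_dims; auto simp: composable_inflate cl cm_assoc vc_assoc hc_assoc)
  next
    fix i j k x y z w assume "i < j" "j < k" and c: "composable (infl T) j k x y" "composable (infl T) j k z w"
      "composable (infl T) i k (gcomp (infl T) j k x y) (gcomp (infl T) j k z w)"
    from c(1) show "gcomp (infl T) i k (gcomp (infl T) j k x y) (gcomp (infl T) j k z w) =
      gcomp (infl T) j k (gcomp (infl T) i k x z) (gcomp (infl T) i k y w)"
    proof (cases rule: composable_dims)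
      case (4 l n)
      then show ?thesis using c(1,2) by (auto simp: composable_inflate)
    qed (use \<open>i < j\<close> c in \<open>auto simp: composable_inflate cl hc_vc\<close>)
  next
    fix i j x assume "i < j" "x \<in> cells (infl T) j"
    then show "gcomp (infl T) i j (id_it (infl T) i j (dom_it (infl T) i j x)) x = x"
      "gcomp (infl T) i j x (id_it (infl T) i j (cod_it (infl T) i j x)) = x"
      by (cases i rule: dim_cases; cases j rule: dim_cases;
          auto simp: it_inflate it_inflate1 id_it_inflate cl cm_unit vc_unit hc_unit
            simp del: dom_it.simps cod_it.simps id_it.simps)+
  next
    fix i j x y assume "composable (infl T) i j x y"
    then show "gcomp (infl T) i (Suc j) (gid (infl T) j x) (gid (infl T) j y) = gid (infl T) j (gcomp (infl T) i j x y)"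
      by (cases rule: composable_dims; auto simp: composable_inflate cl hc_u1 vc_unit)
  qed
qed

end

text \<open>
  The three strengths of maps that are needed: the pseudo-functor has components of the first two
  kinds, \<open>\<kappa>\<close> is of the third.
\<close>

locale two_globular_map = X: two_magma X + Y: two_magma Y
  for X :: "('x, 'y, 'z) two_data" and Y :: "('u, 'v, 'w) two_data" +
  fixes K0 :: "'x \<Rightarrow> 'u" and K1 :: "'y \<Rightarrow> 'v" and K2 :: "'z \<Rightarrow> 'w"
  assumes K0: "a \<in> obs X \<Longrightarrow> K0 a \<in> obs Y"
    and K1: "f \<in> ars X \<Longrightarrow> K1 f \<in> ars Y \<and> s0 Y (K1 f) = K0 (s0 X f) \<and> t0 Y (K1 f) = K0 (t0 X f)"
    and K2: "x \<in> cls X \<Longrightarrow> K2 x \<in> cls Y \<and> s1 Y (K2 x) = K1 (s1 X x) \<and> t1 Y (K2 x) = K1 (t1 X x)"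

locale two_graph_map = two_globular_map +
  assumes K_u0: "a \<in> obs X \<Longrightarrow> K1 (u0 X a) = u0 Y (K0 a)"
    and K_u1: "f \<in> ars X \<Longrightarrow> K2 (u1 X f) = u1 Y (K1 f)"

locale two_magma_map = two_graph_map +
  assumes K_cm: "f \<in> ars X \<Longrightarrow> g \<in> ars X \<Longrightarrow> t0 X f = s0 X g \<Longrightarrow> K1 (cm X f g) = cm Y (K1 f) (K1 g)"
    and K_vc: "x \<in> cls X \<Longrightarrow> y \<in> cls X \<Longrightarrow> t1 X x = s1 X y \<Longrightarrow> K2 (vc X x y) = vc Y (K2 x) (K2 y)"
    and K_hc: "x \<in> cls X \<Longrightarrow> y \<in> cls X \<Longrightarrow> t0 X (s1 X x) = s0 X (s1 X y) \<Longrightarrow> K2 (hc X x y) = hc Y (K2 x) (K2 y)"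

lemma (in omega_graph) bridge_relation_diagonal: "bridge_relation X (diagonal_bridge X)"
  by unfold_locales (auto simp: diagonal_bridge_def parallel_def gid_closed gdom_gid gcod_gid)

text \<open>
  The data of a categorical Penon morphism whose only bridges besides identities are those of
  \<open>B\<close>, in dimension 1. Injectivity of \<open>K0\<close> and faithfulness of \<open>K2\<close> say that identities provide all
  the bridges required in dimensions 0 and 2.
\<close>

locale two_penon_map = two_magma_map + Y: strict_two_category Y +
  fixes B :: "('b \<times> 'b \<times> 'c) set"
  assumes B_cells: "(f, g, x) \<in> B \<Longrightarrow> f \<in> ars X \<and> g \<in> ars X \<and> x \<in> cls X \<and> s1 X x = f \<and> t1 X x = g"
    and B_u1: "f \<in> ars X \<Longrightarrow> (f, f, u1 X f) \<in> B"
    and B_unique: "(f, g, x) \<in> B \<Longrightarrow> (f, g, y) \<in> B \<Longrightarrow> x = y"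
    and B_collapse: "(f, g, x) \<in> B \<Longrightarrow> K1 f = K1 g \<and> K2 x = u1 Y (K1 f)"
    and B_exists: "f \<in> ars X \<Longrightarrow> g \<in> ars X \<Longrightarrow> K1 f = K1 g \<Longrightarrow> \<exists>x. (f, g, x) \<in> B"
    and K0_inj: "inj_on K0 (obs X)"
    and K2_faithful: "x \<in> cls X \<Longrightarrow> y \<in> cls X \<Longrightarrow> s1 X x = s1 X y \<Longrightarrow> t1 X x = t1 X y \<Longrightarrow>
          K2 x = K2 y \<Longrightarrow> x = y"

locale encoding_pair = E: encoding e0 e1 e2 + D: encoding d0 d1 d2
  for e0 :: "'x \<Rightarrow> 's" and e1 :: "'y \<Rightarrow> 's" and e2 :: "'z \<Rightarrow> 's"
    and d0 :: "'u \<Rightarrow> 't" and d1 :: "'v \<Rightarrow> 't" and d2 :: "'w \<Rightarrow> 't"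
begin

definition inflate_map :: "('x \<Rightarrow> 'u) \<Rightarrow> ('y \<Rightarrow> 'v) \<Rightarrow> ('z \<Rightarrow> 'w) \<Rightarrow> nat \<Rightarrow> 's \<Rightarrow> 't" where
  "inflate_map K0 K1 K2 = by_dim (d0 \<circ> K0 \<circ> inv e0) (d1 \<circ> K1 \<circ> inv e1) (d2 \<circ> K2 \<circ> inv e2)"

lemma inflate_map_simps [simp]:
  "inflate_map K0 K1 K2 0 (e0 a) = d0 (K0 a)"
  "inflate_map K0 K1 K2 (Suc 0) (e1 f) = d1 (K1 f)"
  "inflate_map K0 K1 K2 (Suc (Suc n)) (e2 x) = d2 (K2 x)"
  by (simp_all add: inflate_map_def)

lemma globular_inflate_map:
  assumes "two_globular_map X Y K0 K1 K2"
  shows "globular_morphism (E.infl X) (D.infl Y) (inflate_map K0 K1 K2)"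
proof -
  interpret two_globular_map X Y K0 K1 K2 by fact
  interpret X': omega_magma "E.infl X" by (rule E.omega_magma_inflate) unfold_locales
  interpret Y': omega_magma "D.infl Y" by (rule D.omega_magma_inflate) unfold_locales
  show ?thesis
  proof
    fix x i assume "x \<in> cells (E.infl X) i"
    then show "inflate_map K0 K1 K2 i x \<in> cells (D.infl Y) i"
      by (cases i rule: dim_cases) (auto simp: K0 K1 K2)
  next
    fix x i assume "x \<in> cells (E.infl X) (Suc i)"
    then show "inflate_map K0 K1 K2 i (gdom (E.infl X) i x) = gdom (D.infl Y) i (inflate_map K0 K1 K2 (Suc i) x)"
       "inflate_map K0 K1 K2 i (gcod (E.infl X) i x) = gcod (D.infl Y) i (inflate_map K0 K1 K2 (Suc i) x)"
      by (cases i rule: dim_cases; auto simp: K0 K1 K2)+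
  qed
qed

lemma graph_inflate_map:
  assumes "two_graph_map X Y K0 K1 K2"
  shows "omega_graph_morphism (E.infl X) (D.infl Y) (inflate_map K0 K1 K2)"
proof -
  interpret two_graph_map X Y K0 K1 K2 by fact
  interpret X': omega_magma "E.infl X" by (rule E.omega_magma_inflate) unfold_locales
  interpret Y': omega_magma "D.infl Y" by (rule D.omega_magma_inflate) unfold_locales
  interpret globular_morphism "E.infl X" "D.infl Y" "inflate_map K0 K1 K2"
    by (rule globular_inflate_map) unfold_locales
  show ?thesis
  proof
    fix x i assume "x \<in> cells (E.infl X) i"
    then show "inflate_map K0 K1 K2 (Suc i) (gid (E.infl X) i x) = gid (D.infl Y) i (inflate_map K0 K1 K2 i x)"
      by (cases i rule: dim_cases) (auto simp: K_u0 K_u1)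
  qed
qed

lemma magma_inflate_map:
  assumes "two_magma_map X Y K0 K1 K2"
  shows "omega_magma_morphism (E.infl X) (D.infl Y) (inflate_map K0 K1 K2)"
proof -
  interpret two_magma_map X Y K0 K1 K2 by fact
  interpret X': omega_magma "E.infl X" by (rule E.omega_magma_inflate) unfold_locales
  interpret Y': omega_magma "D.infl Y" by (rule D.omega_magma_inflate) unfold_locales
  interpret omega_graph_morphism "E.infl X" "D.infl Y" "inflate_map K0 K1 K2"
    by (rule graph_inflate_map) unfold_locales
  show ?thesis
  proof
    fix i j x y assume "composable (E.infl X) i j x y"
    then show "inflate_map K0 K1 K2 j (gcomp (E.infl X) i j x y)
      = gcomp (D.infl Y) i j (inflate_map K0 K1 K2 j x) (inflate_map K0 K1 K2 j y)"
      by (cases rule: E.composable_dims; auto simp: E.composable_inflate K_cm K_hc K_vc X.cls_closed)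
  qed
qed

definition inflate_bridge :: "('x, 'y, 'z) two_data \<Rightarrow> ('y \<times> 'y \<times> 'z) set \<Rightarrow> nat \<Rightarrow> ('s \<times> 's \<times> 's) set" where
  "inflate_bridge X B n =
    (if n = 1 then {(e1 f, e1 g, e2 x) | f g x. (f, g, x) \<in> B} else diagonal_bridge (E.infl X) n)"

lemma inflate_bridge_simps [simp]:
  "inflate_bridge X B 0 = {(e0 a, e0 a, e1 (u0 X a)) | a. a \<in> obs X}"
  "inflate_bridge X B (Suc 0) = {(e1 f, e1 g, e2 x) | f g x. (f, g, x) \<in> B}"
  "inflate_bridge X B (Suc (Suc n)) = {(e2 x, e2 x, e2 x) | x. x \<in> cls X}"
  by (auto simp: inflate_bridge_def diagonal_bridge_def One_nat_def)

lemma penon_inflate_map: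
  assumes "two_penon_map X Y K0 K1 K2 B"
  shows "bridge_relation (E.infl X) (inflate_bridge X B)"
    and "categorical_penon_morphism (E.infl X) (inflate_bridge X B)
      (D.infl Y) (diagonal_bridge (D.infl Y)) (inflate_map K0 K1 K2)"
proof -
  interpret two_penon_map X Y K0 K1 K2 B by fact
  interpret omega_magma_morphism "E.infl X" "D.infl Y" "inflate_map K0 K1 K2"
    by (rule magma_inflate_map) unfold_locales
  interpret Y': strict_omega_category "D.infl Y"
    by (rule D.strict_omega_category_inflate) unfold_locales
  note cl = X.ars_closed X.cls_closed X.u0_closed X.u1_closed
  interpret X'': bridge_relation "E.infl X" "inflate_bridge X B"
  proof
    fix i
    show "inflate_bridge X B i \<subseteq> cells (E.infl X) i \<times> cells (E.infl X) i \<times> cells (E.infl X) (Suc i)"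
      by (cases i rule: dim_cases) (auto simp: cl dest: B_cells)
  next
    fix i a b c d assume *: "(a, b, c) \<in> inflate_bridge X B i"
    then show "parallel (E.infl X) i a b" "gdom (E.infl X) i c = a" "gcod (E.infl X) i c = b"
      by (cases i rule: dim_cases; auto simp: cl parallel_def dest!: B_cells)+
    show "(a, b, d) \<in> inflate_bridge X B i \<Longrightarrow> c = d"
      using * by (cases i rule: dim_cases) (auto simp: B_unique)
  next
    fix i a assume "a \<in> cells (E.infl X) i"
    then show "(a, a, gid (E.infl X) i a) \<in> inflate_bridge X B i"
      by (cases i rule: dim_cases) (auto simp: B_u1)
  qed
  show "bridge_relation (E.infl X) (inflate_bridge X B)" by unfold_locales
  interpret Y'': bridge_relation "D.infl Y" "diagonal_bridge (D.infl Y)"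
    by (rule omega_graph.bridge_relation_diagonal) unfold_locales
  have collapse: "inflate_map K0 K1 K2 i a = inflate_map K0 K1 K2 i b \<and>
      inflate_map K0 K1 K2 (Suc i) c = gid (D.infl Y) i (inflate_map K0 K1 K2 i a)"
    if "(a, b, c) \<in> inflate_bridge X B i" for i a b c
    using that by (cases i rule: dim_cases) (auto simp: K_u0 dest: B_collapse)
  show "categorical_penon_morphism (E.infl X) (inflate_bridge X B)
      (D.infl Y) (diagonal_bridge (D.infl Y)) (inflate_map K0 K1 K2)"
  proof
    fix i a b c assume R: "(a, b, c) \<in> inflate_bridge X B i"
    then have "inflate_map K0 K1 K2 i a \<in> cells (D.infl Y) i"
      using X''.bridge_cells[of i] by (intro map_closed) auto
    moreover have "inflate_map K0 K1 K2 i b = inflate_map K0 K1 K2 i a"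
      and "inflate_map K0 K1 K2 (Suc i) c = gid (D.infl Y) i (inflate_map K0 K1 K2 i a)"
      using collapse[OF R] by (simp_all only:)
    ultimately show "(inflate_map K0 K1 K2 i a, inflate_map K0 K1 K2 i b, inflate_map K0 K1 K2 (Suc i) c)
        \<in> diagonal_bridge (D.infl Y) i"
      unfolding diagonal_bridge_def by blast
  next
    fix i a b assume *: "parallel (E.infl X) i a b" "inflate_map K0 K1 K2 i a = inflate_map K0 K1 K2 i b"
    show "\<exists>c. (a, b, c) \<in> inflate_bridge X B i"
    proof (cases i rule: dim_cases)
      case 1
      with *(1) obtain x y where xy: "x \<in> obs X" "y \<in> obs X" "a = e0 x" "b = e0 y"
        by (auto simp: parallel_def)
      with *(2) 1 have "x = y" using inj_onD[OF K0_inj] by simp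
      with 1 xy show ?thesis by simp
    next
      case 2
      with *(1) obtain f g where fg: "f \<in> ars X" "g \<in> ars X" "a = e1 f" "b = e1 g"
        by (auto simp: parallel_def)
      with *(2) 2 have "K1 f = K1 g" by simp
      from B_exists[OF fg(1,2) this] 2 fg(3,4) show ?thesis by auto
    next
      case (3 k)
      with *(1) obtain x y where xy: "x \<in> cls X" "y \<in> cls X" "a = e2 x" "b = e2 y"
        by (auto simp: parallel_def)
      have K: "K2 x = K2 y" using *(2) 3 xy(3,4) by simp
      have "x = y"
      proof (cases k)
        case 0
        have "s1 X x = s1 X y" "t1 X x = t1 X y" using *(1) 3 0 xy(3,4) by (simp_all add: parallel_def)
        then show ?thesis using K K2_faithful xy(1,2) by blast
      next
        case (Suc l)
        then show ?thesis using *(1) 3 xy(3,4) by (simp add: parallel_def)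
      qed
      with 3 xy show ?thesis by simp
    qed
  qed (use collapse in blast)+
qed

end


section \<open>The strictification of a bicategory\<close>

context bicategory
begin

text \<open>
  Horizontal composition transported along isomorphisms \<open>m\<close> and \<open>m'\<close> that identify the
  horizontal composites at both ends with other 1-cells.
\<close>

definition hconj :: "'a \<Rightarrow> 'a \<Rightarrow> 'a \<Rightarrow> 'a \<Rightarrow> 'a" where
  "hconj m \<alpha> \<beta> m' = vinv m \<cdot> ((\<alpha> \<star> \<beta>) \<cdot> m')"

lemma hconj_simps [simp]:
  assumes "isoc m" "ce \<alpha>" "ce \<beta>" "ce m'" "tgt (dm \<alpha>) = src (dm \<beta>)" "dm m = dm \<alpha> \<odot> dm \<beta>" "dm m' = cd \<alpha> \<odot> cd \<beta>"
  shows "ce (hconj m \<alpha> \<beta> m')" "dm (hconj m \<alpha> \<beta> m') = cd m" "cd (hconj m \<alpha> \<beta> m') = cd m'"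
    and vcomp_hconj: "m \<cdot> hconj m \<alpha> \<beta> m' = (\<alpha> \<star> \<beta>) \<cdot> m'"
  using assms by (simp_all add: hconj_def)

lemma hconj_vcomp:
  assumes "isoc m" "ce \<alpha>" "ce \<beta>" "isoc m'" "tgt (dm \<alpha>) = src (dm \<beta>)" "dm m = dm \<alpha> \<odot> dm \<beta>" "dm m' = cd \<alpha> \<odot> cd \<beta>"
    and "ce \<alpha>'" "ce \<beta>'" "dm \<alpha>' = cd \<alpha>" "dm \<beta>' = cd \<beta>" "ce m''" "dm m'' = cd \<alpha>' \<odot> cd \<beta>'"
  shows "hconj m (\<alpha> \<cdot> \<alpha>') (\<beta> \<cdot> \<beta>') m'' = hconj m \<alpha> \<beta> m' \<cdot> hconj m' \<alpha>' \<beta>' m''"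
  using assms by (simp add: hconj_def exchange vassoc)

text \<open>
  After cancelling the isomorphism from \<open>(ev p \<odot> ev q) \<odot> ev r\<close> to \<open>ev (p @ q @ r)\<close>, which
  \<open>\<mu>_assoc\<close> expresses in two ways, the claim becomes naturality of the associator.
\<close>

lemma hconj_assoc:
  assumes "is_path p (psrc q (psrc r d))" "is_path q (psrc r d)" "is_path r d"
    and "is_path p' (psrc q' (psrc r' d))" "is_path q' (psrc r' d)" "is_path r' d"
    and "ce \<alpha>" "dm \<alpha> = ev p (psrc q (psrc r d))" "cd \<alpha> = ev p' (psrc q' (psrc r' d))"
    and "ce \<beta>" "dm \<beta> = ev q (psrc r d)" "cd \<beta> = ev q' (psrc r' d)"
    and "ce \<gamma>" "dm \<gamma> = ev r d" "cd \<gamma> = ev r' d"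
  shows "hconj (\<mu> (p @ q) r d) (hconj (\<mu> p q (psrc r d)) \<alpha> \<beta> (\<mu> p' q' (psrc r' d))) \<gamma> (\<mu> (p' @ q') r' d)
    = hconj (\<mu> p (q @ r) d) \<alpha> (hconj (\<mu> q r d) \<beta> \<gamma> (\<mu> q' r' d)) (\<mu> p' (q' @ r') d)"
    (is "?L = ?R")
proof (rule vcancel_left)
  note [simp] = assms
  define x y z x' y' z' where d: "x = ev p (psrc q (psrc r d))" "y = ev q (psrc r d)" "z = ev r d"
    "x' = ev p' (psrc q' (psrc r' d))" "y' = ev q' (psrc r' d)" "z' = ev r' d"
  define k l n o' where m: "k = \<mu> p q (psrc r d)" "l = \<mu> (p @ q) r d" "n = \<mu> q r d" "o' = \<mu> p (q @ r) d"
  define k' l' n' oo' where m': "k' = \<mu> p' q' (psrc r' d)" "l' = \<mu> (p' @ q') r' d"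
    "n' = \<mu> q' r' d" "oo' = \<mu> p' (q' @ r') d"
  have a [simp]: "ar x" "ar y" "ar z" "tgt x = src y" "tgt y = src z" "ar x'" "ar y'" "ar z'" "tgt x' = src y'" "tgt y' = src z'"
    by (simp_all add: d)
  have e [simp]: "dm \<alpha> = x" "cd \<alpha> = x'" "dm \<beta> = y" "cd \<beta> = y'" "dm \<gamma> = z" "cd \<gamma> = z'"
    by (simp_all add: d)
  have i [simp]: "isoc k" "isoc l" "isoc n" "isoc o'" "isoc k'" "isoc l'" "isoc n'" "isoc oo'"
    by (simp_all add: m m')
  have b [simp]: "dm k = x \<odot> y" "dm l = cd k \<odot> z" "dm n = y \<odot> z" "dm o' = x \<odot> cd n" "cd o' = cd l"
    by (simp_all add: m d)
  have b' [simp]: "dm k' = x' \<odot> y'" "dm l' = cd k' \<odot> z'" "dm n' = y' \<odot> z'" "dm oo' = x' \<odot> cd n'" "cd oo' = cd l'"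
    by (simp_all add: m' d)
  note [simp del] = assms
  have [simp]: "ce \<alpha>" "ce \<beta>" "ce \<gamma>" using assms by simp_all
  have s [simp]: "src z' = src z" "src y' = src y"
    using src_tgt_cd(1)[of \<beta>] src_tgt_cd(1)[of \<gamma>] by (simp_all del: src_tgt_cd)
  have s' [simp]: "tgt (cd k) = src z" "src (cd n) = src y" "src (cd k) = src x"
    "tgt (cd k') = src z'" "src (cd n') = src y'" "src (cd k') = src x'"
    by simp_all
  have as: "(k \<star> I z) \<cdot> l = assoc A x y z \<cdot> ((I x \<star> n) \<cdot> o')"
    "(k' \<star> I z') \<cdot> l' = assoc A x' y' z' \<cdot> ((I x' \<star> n') \<cdot> oo')"
    unfolding d m m' using \<mu>_assoc assms by simp_all
  have L: "?L = hconj l (hconj k \<alpha> \<beta> k') \<gamma> l'" and R: "?R = hconj o' \<alpha> (hconj n \<beta> \<gamma> n') oo'"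
    by (simp_all add: m m')
  \<comment> \<open>the isomorphism that is cancelled; \<open>as\<close> rewrites it to pass from one bracketing to the other\<close>
  show "isoc ((k \<star> I z) \<cdot> l)" by simp
  show "ce ?L" "ce ?R" "dm ?L = cd ((k \<star> I z) \<cdot> l)" "dm ?R = cd ((k \<star> I z) \<cdot> l)"
    unfolding L R by simp_all
  have "((k \<star> I z) \<cdot> l) \<cdot> ?L = (k \<star> I z) \<cdot> ((hconj k \<alpha> \<beta> k' \<star> \<gamma>) \<cdot> l')"
    unfolding L by (simp add: vassoc vcomp_hconj)
  also have "\<dots> = ((k \<cdot> hconj k \<alpha> \<beta> k') \<star> (I z \<cdot> \<gamma>)) \<cdot> l'"
    by (simp add: exchange vassoc del: vid vcomp_hconj)
  also have "\<dots> = (((\<alpha> \<star> \<beta>) \<cdot> k') \<star> (\<gamma> \<cdot> I z')) \<cdot> l'"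
    by (simp add: vcomp_hconj)
  also have "\<dots> = ((\<alpha> \<star> \<beta>) \<star> \<gamma>) \<cdot> ((k' \<star> I z') \<cdot> l')"
    by (simp add: exchange vassoc del: vid vcomp_hconj)
  also have "\<dots> = (((\<alpha> \<star> \<beta>) \<star> \<gamma>) \<cdot> assoc A x' y' z') \<cdot> ((I x' \<star> n') \<cdot> oo')"
    by (simp add: as vassoc)
  also have "\<dots> = assoc A x y z \<cdot> (((\<alpha> \<star> (\<beta> \<star> \<gamma>)) \<cdot> (I x' \<star> n')) \<cdot> oo')"
    using assoc_nat[of \<alpha> \<beta> \<gamma>] by (simp add: vassoc)
  also have "\<dots> = assoc A x y z \<cdot> (((I x \<cdot> \<alpha>) \<star> (n \<cdot> hconj n \<beta> \<gamma> n')) \<cdot> oo')"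
    by (simp add: vcomp_hconj flip: exchange)
  also have "\<dots> = assoc A x y z \<cdot> ((I x \<star> n) \<cdot> ((\<alpha> \<star> hconj n \<beta> \<gamma> n') \<cdot> oo'))"
    by (simp add: exchange vassoc del: vid vcomp_hconj)
  also have "\<dots> = ((k \<star> I z) \<cdot> l) \<cdot> ?R"
    unfolding R as by (simp add: vassoc vcomp_hconj)
  finally show "((k \<star> I z) \<cdot> l) \<cdot> ?L = ((k \<star> I z) \<cdot> l) \<cdot> ?R" .
qed

lemma hconj_U_left:
  assumes "is_path q c" "is_path q' c" "ce \<beta>" "dm \<beta> = ev q c" "cd \<beta> = ev q' c"
  shows "hconj (\<mu> [] q c) (I (U (psrc q c))) \<beta> (\<mu> [] q' c) = \<beta>"
  using lunit_nat[of \<beta>] assms by (simp add: hconj_def)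

lemma hconj_U_right:
  assumes "is_path q c" "is_path q' c" "ce \<beta>" "dm \<beta> = ev q c" "cd \<beta> = ev q' c"
  shows "hconj (\<mu> q [] c) \<beta> (I (U c)) (\<mu> q' [] c) = \<beta>"
  using runit_nat[of \<beta>] assms by (simp add: hconj_def \<mu>_Nil)

lemma hconj_I:
  assumes "is_path p (psrc q c)" "is_path q c"
  shows "hconj (\<mu> p q c) (I (ev p (psrc q c))) (I (ev q c)) (\<mu> p q c) = I (ev (p @ q) c)"
  using assms by (simp add: hconj_def hid)

definition path where "path P \<longleftrightarrow> is_path (fst P) (snd P)"
definition evp where "evp P = ev (fst P) (snd P)"

text \<open>
  The paths at the two ends are part of a 2-cell because \<open>ev\<close> is not injective on paths.
\<close>

definition strictification ::
    "('a, 'a list \<times> 'a, ('a list \<times> 'a) \<times> ('a list \<times> 'a) \<times> 'a) two_data" where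
  "strictification =
    \<lparr> obs = cells A 0,
      ars = {P. path P},
      cls = {(P, Q, \<alpha>). path P \<and> path Q \<and> ce \<alpha> \<and> dm \<alpha> = evp P \<and> cd \<alpha> = evp Q},
      s0 = \<lambda>(p, b). psrc p b,
      t0 = snd,
      s1 = fst,
      t1 = \<lambda>(P, Q, \<alpha>). Q,
      u0 = \<lambda>a. ([], a),
      u1 = \<lambda>P. (P, P, I (evp P)),
      cm = \<lambda>(p, b) (q, c). (p @ q, c),
      hc = \<lambda>((p, b), (p', b'), \<alpha>) ((q, c), (q', c'), \<beta>).
        ((p @ q, c), (p' @ q', c'), hconj (\<mu> p q c) \<alpha> \<beta> (\<mu> p' q' c')),
      vc = \<lambda>(P, Q, \<alpha>) (Q', R, \<beta>). (P, R, \<alpha> \<cdot> \<beta>) \<rparr>"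

text \<open>
  A 2-cell between evaluations forces the paths to be parallel, so the strictification needs no
  separate condition for this.
\<close>

lemma parallel_paths:
  assumes "is_path p b" "is_path q c" "ce \<alpha>" "dm \<alpha> = ev p b" "cd \<alpha> = ev q c"
  shows "b = c" "psrc p b = psrc q c"
  using src_tgt_cd[OF assms(3)] assms by (simp_all del: src_tgt_cd)

lemma strictification_cells:
  "P \<in> ars strictification \<longleftrightarrow> (\<exists>p b. P = (p, b) \<and> is_path p b)"
  "x \<in> cls strictification \<longleftrightarrow> (\<exists>p q b \<alpha>. x = ((p, b), (q, b), \<alpha>) \<and>
    is_path p b \<and> is_path q b \<and> psrc q b = psrc p b \<and> ce \<alpha> \<and> dm \<alpha> = ev p b \<and> cd \<alpha> = ev q b)"
proof -
  show "P \<in> ars strictification \<longleftrightarrow> (\<exists>p b. P = (p, b) \<and> is_path p b)"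
    by (cases P) (simp add: strictification_def path_def)
  show "x \<in> cls strictification \<longleftrightarrow> (\<exists>p q b \<alpha>. x = ((p, b), (q, b), \<alpha>) \<and>
    is_path p b \<and> is_path q b \<and> psrc q b = psrc p b \<and> ce \<alpha> \<and> dm \<alpha> = ev p b \<and> cd \<alpha> = ev q b)"
  proof -
    obtain p b q c \<alpha> where x: "x = ((p, b), (q, c), \<alpha>)" by (metis prod.exhaust)
    show ?thesis
      unfolding x using parallel_paths[of p b q c \<alpha>] by (auto simp: strictification_def path_def evp_def)
  qed
qed

lemma strictification_ops:
  "obs strictification = cells A 0"
  "s0 strictification (p, b) = psrc p b" "t0 strictification (p, b) = b"
  "s1 strictification (P, Q, \<alpha>) = P" "t1 strictification (P, Q, \<alpha>) = Q"
  "u0 strictification b = ([], b)" "u1 strictification (p, b) = ((p, b), (p, b), I (ev p b))"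
  "cm strictification (p, b) (q, c) = (p @ q, c)"
  "hc strictification ((p, b), (p', b'), \<alpha>) ((q, c), (q', c'), \<beta>)
    = ((p @ q, c), (p' @ q', c'), hconj (\<mu> p q c) \<alpha> \<beta> (\<mu> p' q' c'))"
  "vc strictification (P, Q, \<alpha>) (Q', R, \<beta>) = (P, R, \<alpha> \<cdot> \<beta>)"
  by (simp_all add: strictification_def evp_def)

lemma strict_strictification: "strict_two_category strictification"
proof
  note [simp] = strictification_cells strictification_ops
  show "hc strictification (hc strictification x y) z = hc strictification x (hc strictification y z)"
    if "x \<in> cls strictification" "y \<in> cls strictification" "z \<in> cls strictification"
      "t0 strictification (s1 strictification x) = s0 strictification (s1 strictification y)"
      "t0 strictification (s1 strictification y) = s0 strictification (s1 strictification z)" for x y z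
  proof -
    from that obtain p p' q q' r r' d \<alpha> \<beta> \<gamma> where *:
      "x = ((p, psrc q (psrc r d)), (p', psrc q (psrc r d)), \<alpha>)"
      "y = ((q, psrc r d), (q', psrc r d), \<beta>)" "z = ((r, d), (r', d), \<gamma>)"
      by (auto simp del: \<mu>.simps)
    with that hconj_assoc[of p q r d p' q' r' \<alpha> \<beta> \<gamma>] show ?thesis by simp
  qed
  show "hc strictification (u1 strictification (u0 strictification (s0 strictification (s1 strictification x)))) x = x \<and>
         hc strictification x (u1 strictification (u0 strictification (t0 strictification (s1 strictification x)))) = x"
    if "x \<in> cls strictification" for x
    using that by (auto simp del: \<mu>.simps simp: hconj_U_left hconj_U_right)
  show "hc strictification (vc strictification x y) (vc strictification z w) =
       vc strictification (hc strictification x z) (hc strictification y w)"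
    if "x \<in> cls strictification" "y \<in> cls strictification" "z \<in> cls strictification" "w \<in> cls strictification"
      "t1 strictification x = s1 strictification y" "t1 strictification z = s1 strictification w"
      "t0 strictification (s1 strictification x) = s0 strictification (s1 strictification z)" for x y z w
    using that by (auto intro!: hconj_vcomp simp del: \<mu>.simps)
qed (auto simp: strictification_cells strictification_ops hconj_I vassoc simp del: \<mu>.simps)

end

section \<open>The resolution of a bicategory\<close>

context bicategory
begin

text \<open>
  A 1-cell is a path with an invertible 2-cell \<open>\<nu>\<close> into its evaluation; the 1-cell of the bicategory
  that it stands for is \<open>dm \<nu>\<close>. Composition on the \<open>dm \<nu>\<close> and on the 2-cells is the one of the
  bicategory, so that projecting to it is strict.
\<close>

definition resolution ::
    "('a, ('a list \<times> 'a) \<times> 'a, (('a list \<times> 'a) \<times> 'a) \<times> (('a list \<times> 'a) \<times> 'a) \<times> 'a) two_data" where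
  "resolution =
    \<lparr> obs = cells A 0,
      ars = {(P, \<nu>). path P \<and> isoc \<nu> \<and> cd \<nu> = evp P},
      cls = {((P, \<nu>), (Q, \<nu>'), \<alpha>). path P \<and> isoc \<nu> \<and> cd \<nu> = evp P \<and> path Q \<and> isoc \<nu>' \<and> cd \<nu>' = evp Q \<and>
        ce \<alpha> \<and> dm \<alpha> = dm \<nu> \<and> cd \<alpha> = dm \<nu>'},
      s0 = \<lambda>((p, b), \<nu>). psrc p b,
      t0 = \<lambda>((p, b), \<nu>). b,
      s1 = fst,
      t1 = \<lambda>(S, T, \<alpha>). T,
      u0 = \<lambda>a. (([], a), I (U a)),
      u1 = \<lambda>(P, \<nu>). ((P, \<nu>), (P, \<nu>), I (dm \<nu>)),
      cm = \<lambda>((p, b), \<nu>) ((q, c), \<nu>'). ((p @ q, c), (\<nu> \<star> \<nu>') \<cdot> \<mu> p q c),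
      hc = \<lambda>(((p, b), \<nu>1), ((p', b'), \<nu>1'), \<alpha>) (((q, c), \<nu>2), ((q', c'), \<nu>2'), \<beta>).
        (((p @ q, c), (\<nu>1 \<star> \<nu>2) \<cdot> \<mu> p q c), ((p' @ q', c'), (\<nu>1' \<star> \<nu>2') \<cdot> \<mu> p' q' c'), \<alpha> \<star> \<beta>),
      vc = \<lambda>(S, T, \<alpha>) (T', R, \<beta>). (S, R, \<alpha> \<cdot> \<beta>) \<rparr>"

lemma resolution_cells:
  "S \<in> ars resolution \<longleftrightarrow> (\<exists>p b \<nu>. S = ((p, b), \<nu>) \<and> is_path p b \<and> isoc \<nu> \<and> cd \<nu> = ev p b \<and>
    src (dm \<nu>) = psrc p b \<and> tgt (dm \<nu>) = b)"
  "x \<in> cls resolution \<longleftrightarrow> (\<exists>p q b \<nu> \<nu>' \<alpha>. x = (((p, b), \<nu>), ((q, b), \<nu>'), \<alpha>) \<and>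
    is_path p b \<and> is_path q b \<and> psrc q b = psrc p b \<and> isoc \<nu> \<and> isoc \<nu>' \<and> cd \<nu> = ev p b \<and> cd \<nu>' = ev q b \<and>
    src (dm \<nu>) = psrc p b \<and> tgt (dm \<nu>) = b \<and> src (dm \<nu>') = psrc p b \<and> tgt (dm \<nu>') = b \<and>
    ce \<alpha> \<and> dm \<alpha> = dm \<nu> \<and> cd \<alpha> = dm \<nu>')"
proof -
  have ends: "src (dm \<nu>) = psrc p b" "tgt (dm \<nu>) = b" if "isoc \<nu>" "cd \<nu> = ev p b" "is_path p b" for \<nu> p b
    using src_tgt_cd[of \<nu>] that by (simp_all del: src_tgt_cd)
  show "S \<in> ars resolution \<longleftrightarrow> (\<exists>p b \<nu>. S = ((p, b), \<nu>) \<and> is_path p b \<and> isoc \<nu> \<and> cd \<nu> = ev p b \<and>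
    src (dm \<nu>) = psrc p b \<and> tgt (dm \<nu>) = b)"
  proof -
    obtain p b \<nu> where S: "S = ((p, b), \<nu>)" by (metis prod.exhaust)
    have "S \<in> ars resolution \<longleftrightarrow> is_path p b \<and> isoc \<nu> \<and> cd \<nu> = ev p b"
      by (simp add: S resolution_def path_def evp_def)
    then show ?thesis unfolding S using ends by blast
  qed
  obtain p b q c \<nu> \<nu>' \<alpha> where x: "x = (((p, b), \<nu>), ((q, c), \<nu>'), \<alpha>)" by (metis prod.exhaust)
  have par: "b = c" "psrc q c = psrc p b"
    if "isoc \<nu>" "cd \<nu> = ev p b" "is_path p b" "isoc \<nu>'" "cd \<nu>' = ev q c" "is_path q c"
      "ce \<alpha>" "dm \<alpha> = dm \<nu>" "cd \<alpha> = dm \<nu>'"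
    using ends[of \<nu> p b] ends[of \<nu>' q c] src_tgt_cd[of \<alpha>] that by (simp_all del: src_tgt_cd)
  show "x \<in> cls resolution \<longleftrightarrow> (\<exists>p q b \<nu> \<nu>' \<alpha>. x = (((p, b), \<nu>), ((q, b), \<nu>'), \<alpha>) \<and>
    is_path p b \<and> is_path q b \<and> psrc q b = psrc p b \<and> isoc \<nu> \<and> isoc \<nu>' \<and> cd \<nu> = ev p b \<and> cd \<nu>' = ev q b \<and>
    src (dm \<nu>) = psrc p b \<and> tgt (dm \<nu>) = b \<and> src (dm \<nu>') = psrc p b \<and> tgt (dm \<nu>') = b \<and>
    ce \<alpha> \<and> dm \<alpha> = dm \<nu> \<and> cd \<alpha> = dm \<nu>')"
  proof -
    have "x \<in> cls resolution \<longleftrightarrow> is_path p b \<and> isoc \<nu> \<and> cd \<nu> = ev p b \<and>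
        is_path q c \<and> isoc \<nu>' \<and> cd \<nu>' = ev q c \<and> ce \<alpha> \<and> dm \<alpha> = dm \<nu> \<and> cd \<alpha> = dm \<nu>'"
      by (simp add: x resolution_def path_def evp_def)
    moreover have "b = c \<and> psrc q c = psrc p b \<and> src (dm \<nu>) = psrc p b \<and> tgt (dm \<nu>) = b \<and>
        src (dm \<nu>') = psrc p b \<and> tgt (dm \<nu>') = b"
      if *: "is_path p b" "isoc \<nu>" "cd \<nu> = ev p b" "is_path q c" "isoc \<nu>'" "cd \<nu>' = ev q c"
        "ce \<alpha>" "dm \<alpha> = dm \<nu>" "cd \<alpha> = dm \<nu>'"
    proof -
      note e = ends[OF *(2,3,1)] ends[OF *(5,6,4)] and p = par[OF *(2,3,1,5,6,4,7,8,9)]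
      show ?thesis unfolding e p(2) using p(1) by simp
    qed
    ultimately show ?thesis unfolding x by blast
  qed
qed

lemma resolution_ops:
  "obs resolution = cells A 0"
  "s0 resolution ((p, b), \<nu>) = psrc p b" "t0 resolution ((p, b), \<nu>) = b"
  "s1 resolution (S, T, \<alpha>) = S" "t1 resolution (S, T, \<alpha>) = T"
  "u0 resolution b = (([], b), I (U b))" "u1 resolution (P, \<nu>) = ((P, \<nu>), (P, \<nu>), I (dm \<nu>))"
  "cm resolution ((p, b), \<nu>) ((q, c), \<nu>') = ((p @ q, c), (\<nu> \<star> \<nu>') \<cdot> \<mu> p q c)"
  "hc resolution (((p, b), \<nu>1), ((p', b'), \<nu>1'), \<alpha>) (((q, c), \<nu>2), ((q', c'), \<nu>2'), \<beta>)
    = (((p @ q, c), (\<nu>1 \<star> \<nu>2) \<cdot> \<mu> p q c), ((p' @ q', c'), (\<nu>1' \<star> \<nu>2') \<cdot> \<mu> p' q' c'), \<alpha> \<star> \<beta>)"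
  "vc resolution (S, T, \<alpha>) (T', R, \<beta>) = (S, R, \<alpha> \<cdot> \<beta>)"
  by (simp_all add: resolution_def)

lemma two_magma_resolution: "two_magma resolution"
  by unfold_locales (auto simp: resolution_cells resolution_ops simp del: \<mu>.simps)

text \<open>
  The action of \<open>\<kappa>\<close> on 2-cells.
\<close>

definition straighten ::
    "(('a list \<times> 'a) \<times> 'a) \<times> (('a list \<times> 'a) \<times> 'a) \<times> 'a \<Rightarrow> ('a list \<times> 'a) \<times> ('a list \<times> 'a) \<times> 'a" where
  "straighten = (\<lambda>((P, \<nu>), (Q, \<nu>'), \<alpha>). (P, Q, vinv \<nu> \<cdot> (\<alpha> \<cdot> \<nu>')))"

lemma straighten_simps [simp]: "straighten ((P, \<nu>), (Q, \<nu>'), \<alpha>) = (P, Q, vinv \<nu> \<cdot> (\<alpha> \<cdot> \<nu>'))"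
  by (simp add: straighten_def)

text \<open>
  The bridges between 1-cells over the same path: the unique 2-cell that \<open>straighten\<close> sends to an
  identity.
\<close>

definition coherence_cells where
  "coherence_cells = {((P, \<nu>), (P, \<nu>'), ((P, \<nu>), (P, \<nu>'), \<nu> \<cdot> vinv \<nu>')) | P \<nu> \<nu>'.
    (P, \<nu>) \<in> ars resolution \<and> (P, \<nu>') \<in> ars resolution}"

text \<open>
  Compatibility with horizontal composition is where the choices fit together: composition in the
  resolution appends \<open>\<mu>\<close> to \<open>\<nu>\<close>, and composition in the strictification conjugates by \<open>\<mu>\<close>.
\<close>

lemma penon_straighten: "two_penon_map resolution strictification id fst straighten coherence_cells"
proof -
  interpret X: two_magma resolution by (rule two_magma_resolution)
  interpret Y: strict_two_category strictification by (rule strict_strictification)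
  note [simp] = resolution_cells resolution_ops strictification_cells strictification_ops
    and [simp del] = \<mu>.simps
  show ?thesis
  proof
    fix x y assume "x \<in> cls resolution" "y \<in> cls resolution"
      "t0 resolution (s1 resolution x) = s0 resolution (s1 resolution y)"
    then show "straighten (hc resolution x y) = hc strictification (straighten x) (straighten y)"
      by (auto simp: hconj_def vinv_of_vcomp vinv_of_hcomp exchange vassoc)
  next
    fix x y assume "x \<in> cls resolution" "y \<in> cls resolution"
      and s: "s1 resolution x = s1 resolution y" "t1 resolution x = t1 resolution y" "straighten x = straighten y"
    then obtain P Q \<nu> \<nu>' \<alpha> \<beta> where *: "x = ((P, \<nu>), (Q, \<nu>'), \<alpha>)" "y = ((P, \<nu>), (Q, \<nu>'), \<beta>)"
      "isoc \<nu>" "isoc \<nu>'" "ce \<alpha>" "dm \<alpha> = dm \<nu>" "cd \<alpha> = dm \<nu>'" "ce \<beta>" "dm \<beta> = dm \<nu>" "cd \<beta> = dm \<nu>'"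
      by auto
    with s(3) have "vinv \<nu> \<cdot> (\<alpha> \<cdot> \<nu>') = vinv \<nu> \<cdot> (\<beta> \<cdot> \<nu>')" by simp
    then have "\<alpha> \<cdot> \<nu>' = \<beta> \<cdot> \<nu>'" by (rule vcancel_left) (simp_all add: *)
    then have "\<alpha> = \<beta>" by (rule vcancel_right) (simp_all add: *)
    with * show "x = y" by simp
  next
    fix f g assume fg: "f \<in> ars resolution" "g \<in> ars resolution" "fst f = fst g"
    then obtain P \<nu> \<nu>' where "f = (P, \<nu>)" "g = (P, \<nu>')" by (metis prod.collapse)
    with fg show "\<exists>x. (f, g, x) \<in> coherence_cells"
      unfolding coherence_cells_def by blast
  next
    fix f assume "f \<in> ars resolution"
    then show "(f, f, u1 resolution f) \<in> coherence_cells"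
      by (auto simp: coherence_cells_def)
  qed (auto simp: coherence_cells_def vassoc)
qed

end

section \<open>Two-skeletal magmas\<close>

lemma truncate_simps [simp]:
  "cells (omega_magma.truncate M) = cells M"
  "gdom (omega_magma.truncate M) = gdom M"
  "gcod (omega_magma.truncate M) = gcod M"
  "gid (omega_magma.truncate M) = gid M"
  "gcomp (omega_magma.truncate M) = gcomp M"
  by (simp_all add: omega_magma.truncate_def)

lemma it_truncate [simp]:
  "dom_it (omega_magma.truncate M) i j x = dom_it M i j x"
  "cod_it (omega_magma.truncate M) i j x = cod_it M i j x"
  by (induction j arbitrary: x) simp_all

lemma composable_truncate [simp]: "composable (omega_magma.truncate M) = composable M"
  by (intro ext) (simp add: composable_def)

lemma (in omega_magma) omega_magma_truncate: "omega_magma (omega_magma.truncate X)"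
  by unfold_locales
    (simp_all add: gdom_closed gcod_closed gdom_gdom gcod_gdom gid_closed gdom_gid gcod_gid
      gcomp_closed gdom_gcomp gcod_gcomp gdom_gcomp_less gcod_gcomp_less)

context globular_morphism
begin

lemma map_it:
  assumes "x \<in> cells X j"
  shows "i \<le> j \<longrightarrow> F i (dom_it X i j x) = dom_it Y i j (F j x)"
    and "i \<le> j \<longrightarrow> F i (cod_it X i j x) = cod_it Y i j (F j x)"
  using assms
  by (induction j arbitrary: x)
    (auto simp: map_gdom map_gcod X.gdom_closed X.gcod_closed le_Suc_eq)

lemma map_composable: "composable X i j x y \<Longrightarrow> composable Y i j (F j x) (F j y)"
  using map_it[of x j i] map_it[of y j i] by (auto simp: composable_def map_closed)

end

text \<open>
  In a 2-skeletal magma a cell of dimension above 2 is the identity on its own domain. The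
  maps \<open>up\<close> and \<open>down\<close> are therefore inverse bijections between 2-cells and cells of dimension
  \<open>n + 2\<close>, and composites in those dimensions are computed by comparing domains.
\<close>

locale two_skeletal_magma = omega_magma M for M :: "'a omega_magma" +
  assumes skeletal: "skeletal 2 M"
begin

primrec up :: "nat \<Rightarrow> 'a \<Rightarrow> 'a" where
  "up 0 x = x"
| "up (Suc n) x = gid M (Suc (Suc n)) (up n x)"

primrec down :: "nat \<Rightarrow> 'a \<Rightarrow> 'a" where
  "down 0 x = x"
| "down (Suc n) x = down n (gdom M (Suc (Suc n)) x)"

lemma degenerate:
  assumes "x \<in> cells M (Suc (Suc (Suc n)))"
  shows "gid M (Suc (Suc n)) (gdom M (Suc (Suc n)) x) = x"
    and "gcod M (Suc (Suc n)) x = gdom M (Suc (Suc n)) x"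
proof -
  have "2 \<le> Suc (Suc n)" by simp
  with assms obtain y where "y \<in> cells M (Suc (Suc n))" "x = gid M (Suc (Suc n)) y"
    using skeletal unfolding skeletal_def by blast
  then show "gid M (Suc (Suc n)) (gdom M (Suc (Suc n)) x) = x"
    "gcod M (Suc (Suc n)) x = gdom M (Suc (Suc n)) x"
    by (simp_all add: gdom_gid gcod_gid)
qed

lemma up_closed: "x \<in> cells M 2 \<Longrightarrow> up n x \<in> cells M (Suc (Suc n))"
  by (induction n) (simp_all add: numeral_2_eq_2 gid_closed)

lemma down_closed: "x \<in> cells M (Suc (Suc n)) \<Longrightarrow> down n x \<in> cells M 2"
  by (induction n arbitrary: x) (simp_all add: numeral_2_eq_2 gdom_closed)

lemma up_down: "x \<in> cells M (Suc (Suc n)) \<Longrightarrow> up n (down n x) = x"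
  by (induction n arbitrary: x) (simp_all add: gdom_closed degenerate)

lemma up_Suc_ends:
  assumes "x \<in> cells M 2"
  shows "gdom M (Suc (Suc n)) (up (Suc n) x) = up n x" "gcod M (Suc (Suc n)) (up (Suc n) x) = up n x"
  using up_closed[OF assms, of n] by (simp_all add: gdom_gid gcod_gid)

lemma up_unique:
  assumes "x \<in> cells M (Suc (Suc (Suc n)))" "y \<in> cells M (Suc (Suc (Suc n)))"
    "gdom M (Suc (Suc n)) x = gdom M (Suc (Suc n)) y"
  shows "x = y"
  using assms degenerate(1) by metis

lemma gcomp_up:
  assumes "i < 2" "x \<in> cells M 2" "y \<in> cells M 2" "\<And>n. composable M i (Suc (Suc n)) (up n x) (up n y)"
  shows "gcomp M i (Suc (Suc n)) (up n x) (up n y) = up n (gcomp M i 2 x y)"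
proof (induction n)
  case 0
  then show ?case by (simp add: numeral_2_eq_2)
next
  case (Suc n)
  have c: "gcomp M i 2 x y \<in> cells M 2"
    using gcomp_closed[OF assms(4)[of 0]] by (simp add: numeral_2_eq_2)
  show ?case
  proof (rule up_unique)
    show "gcomp M i (Suc (Suc (Suc n))) (up (Suc n) x) (up (Suc n) y) \<in> cells M (Suc (Suc (Suc n)))"
      by (rule gcomp_closed[OF assms(4)])
    show "up (Suc n) (gcomp M i 2 x y) \<in> cells M (Suc (Suc (Suc n)))"
      by (rule up_closed[OF c])
    have "i < Suc (Suc n)" using assms(1) by simp
    from gdom_gcomp_less[OF this assms(4)[of "Suc n"]] Suc
    show "gdom M (Suc (Suc n)) (gcomp M i (Suc (Suc (Suc n))) (up (Suc n) x) (up (Suc n) y))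
      = gdom M (Suc (Suc n)) (up (Suc n) (gcomp M i 2 x y))"
      by (simp only: up_Suc_ends[OF assms(2)] up_Suc_ends[OF assms(3)] up_Suc_ends[OF c])
  qed
qed

text \<open>
  Cells composable along a cell of dimension at least 2 coincide, and their composite has the same
  domain as they have.
\<close>

lemma gcomp_up_same:
  assumes "x \<in> cells M 2" "k < n"
    and "\<And>n. k < n \<Longrightarrow> composable M (Suc (Suc k)) (Suc (Suc n)) (up n x) (up n x)"
  shows "gcomp M (Suc (Suc k)) (Suc (Suc n)) (up n x) (up n x) = up n x"
  using assms(2)
proof (induction n)
  case 0
  then show ?case by simp
next
  case (Suc n)
  note c = assms(3)[OF Suc.prems]
  show ?case
  proof (rule up_unique)
    show "gcomp M (Suc (Suc k)) (Suc (Suc (Suc n))) (up (Suc n) x) (up (Suc n) x) \<in> cells M (Suc (Suc (Suc n)))"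
      by (rule gcomp_closed[OF c])
    show "up (Suc n) x \<in> cells M (Suc (Suc (Suc n)))"
      by (rule up_closed[OF assms(1)])
    show "gdom M (Suc (Suc n)) (gcomp M (Suc (Suc k)) (Suc (Suc (Suc n))) (up (Suc n) x) (up (Suc n) x))
      = gdom M (Suc (Suc n)) (up (Suc n) x)"
    proof (cases "k = n")
      case True
      then show ?thesis using gdom_gcomp[of "Suc (Suc n)" "up (Suc n) x" "up (Suc n) x"] c by simp
    next
      case False
      then have "k < n" using Suc.prems by simp
      then have "Suc (Suc k) < Suc (Suc n)" by simp
      from gdom_gcomp_less[OF this c] Suc.IH[OF \<open>k < n\<close>]
      show ?thesis by (simp only: up_Suc_ends[OF assms(1)])
    qed
  qed
qed

end

text \<open>
  A strict map from two-dimensional data into a 2-skeletal magma, such as \<open>\<lambda>\<close>.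
\<close>

locale realisation = T: two_magma T + M: two_skeletal_magma M
  for T :: "('x, 'y, 'z) two_data" and M :: "'a omega_magma" +
  fixes L0 :: "'x \<Rightarrow> 'a" and L1 :: "'y \<Rightarrow> 'a" and L2 :: "'z \<Rightarrow> 'a"
  assumes L0: "a \<in> obs T \<Longrightarrow> L0 a \<in> cells M 0"
    and L1: "f \<in> ars T \<Longrightarrow> L1 f \<in> cells M 1 \<and> gdom M 0 (L1 f) = L0 (s0 T f) \<and> gcod M 0 (L1 f) = L0 (t0 T f)"
    and L2: "x \<in> cls T \<Longrightarrow> L2 x \<in> cells M 2 \<and> gdom M 1 (L2 x) = L1 (s1 T x) \<and> gcod M 1 (L2 x) = L1 (t1 T x)"
    and L_u0: "a \<in> obs T \<Longrightarrow> L1 (u0 T a) = gid M 0 (L0 a)"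
    and L_u1: "f \<in> ars T \<Longrightarrow> L2 (u1 T f) = gid M 1 (L1 f)"
    and L_cm: "f \<in> ars T \<Longrightarrow> g \<in> ars T \<Longrightarrow> t0 T f = s0 T g \<Longrightarrow> L1 (cm T f g) = gcomp M 0 1 (L1 f) (L1 g)"
    and L_vc: "x \<in> cls T \<Longrightarrow> y \<in> cls T \<Longrightarrow> t1 T x = s1 T y \<Longrightarrow> L2 (vc T x y) = gcomp M 1 2 (L2 x) (L2 y)"
    and L_hc: "x \<in> cls T \<Longrightarrow> y \<in> cls T \<Longrightarrow> t0 T (s1 T x) = s0 T (s1 T y) \<Longrightarrow> L2 (hc T x y) = gcomp M 0 2 (L2 x) (L2 y)"

context encoding
begin

definition realise :: "'a omega_magma \<Rightarrow> ('x \<Rightarrow> 'a) \<Rightarrow> ('y \<Rightarrow> 'a) \<Rightarrow> ('z \<Rightarrow> 'a) \<Rightarrow> nat \<Rightarrow> 't \<Rightarrow> 'a" where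
  "realise M L0 L1 L2 n =
    by_dim (L0 \<circ> inv e0) (L1 \<circ> inv e1) (two_skeletal_magma.up M (n - 2) \<circ> L2 \<circ> inv e2) n"

lemma realise_simps [simp]:
  "realise M L0 L1 L2 0 (e0 a) = L0 a"
  "realise M L0 L1 L2 (Suc 0) (e1 f) = L1 f"
  "realise M L0 L1 L2 (Suc (Suc n)) (e2 x) = two_skeletal_magma.up M n (L2 x)"
  by (simp_all add: realise_def)

lemma magma_realise:
  assumes "realisation T M L0 L1 L2"
  shows "omega_magma_morphism (infl T) M (realise M L0 L1 L2)"
proof -
  interpret realisation T M L0 L1 L2 by fact
  interpret T': omega_magma "infl T" by (rule omega_magma_inflate) unfold_locales
  note L1' = L1[unfolded One_nat_def] and L2' = L2[unfolded numeral_2_eq_2 One_nat_def]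
    and Lu = L_u0 L_u1[unfolded One_nat_def]
  have up1: "M.up n (L2 x) \<in> cells M (Suc (Suc n))" if "x \<in> cls T" for n x
    using M.up_closed L2 that by simp
  interpret globular_morphism "infl T" M "realise M L0 L1 L2"
  proof
    fix x i assume "x \<in> cells (infl T) i"
    then show "realise M L0 L1 L2 i x \<in> cells M i"
      by (cases i rule: dim_cases) (auto simp: L0 L1' up1)
  next
    fix x i assume *: "x \<in> cells (infl T) (Suc i)"
    have "realise M L0 L1 L2 i (gdom (infl T) i x) = gdom M i (realise M L0 L1 L2 (Suc i) x)
      \<and> realise M L0 L1 L2 i (gcod (infl T) i x) = gcod M i (realise M L0 L1 L2 (Suc i) x)"
    proof (cases i rule: dim_cases)
      case 1 then show ?thesis using * by (auto simp: L1')
    next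
      case 2 then show ?thesis using * by (auto simp: L2')
    next
      case (3 n)
      with * obtain z where "z \<in> cls T" "x = e2 z" by auto
      with 3 M.up_Suc_ends[of "L2 z" n] L2[of z] show ?thesis by (simp del: M.up.simps)
    qed
    then show "realise M L0 L1 L2 i (gdom (infl T) i x) = gdom M i (realise M L0 L1 L2 (Suc i) x)"
      "realise M L0 L1 L2 i (gcod (infl T) i x) = gcod M i (realise M L0 L1 L2 (Suc i) x)" by blast+
  qed
  show ?thesis
  proof
    fix x i assume "x \<in> cells (infl T) i"
    then show "realise M L0 L1 L2 (Suc i) (gid (infl T) i x) = gid M i (realise M L0 L1 L2 i x)"
      by (cases i rule: dim_cases) (auto simp: Lu)
  next
    fix i j x y assume *: "composable (infl T) i j x y"
    then show "realise M L0 L1 L2 j (gcomp (infl T) i j x y)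
      = gcomp M i j (realise M L0 L1 L2 j x) (realise M L0 L1 L2 j y)"
    proof (cases rule: composable_dims)
      case 1
      then show ?thesis using * by (auto simp: composable_inflate L_cm One_nat_def)
    next
      case (2 n)
      with * obtain z w where zw: "z \<in> cls T" "w \<in> cls T" "x = e2 z" "y = e2 w" "t0 T (s1 T z) = s0 T (s1 T w)"
        by (auto simp: composable_inflate T.cls_closed)
      have "composable (infl T) 0 (Suc (Suc m)) x y" for m
        using * 2 by (auto simp: composable_inflate)
      from map_composable[OF this] have "composable M 0 (Suc (Suc m)) (M.up m (L2 z)) (M.up m (L2 w))" for m
        by (simp add: zw(3,4))
      from M.gcomp_up[OF _ _ _ this, of n] zw 2 L2 show ?thesis by (simp add: L_hc)
    next
      case (3 n)
      with * obtain z w where zw: "z \<in> cls T" "w \<in> cls T" "x = e2 z" "y = e2 w" "t1 T z = s1 T w"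
        by (auto simp: composable_inflate)
      have "composable (infl T) (Suc 0) (Suc (Suc m)) x y" for m
        using * 3 by (auto simp: composable_inflate)
      from map_composable[OF this] have "composable M (Suc 0) (Suc (Suc m)) (M.up m (L2 z)) (M.up m (L2 w))" for m
        by (simp add: zw(3,4))
      from M.gcomp_up[OF _ _ _ this, of n] zw 3 L2 show ?thesis by (simp add: L_vc One_nat_def)
    next
      case (4 k n)
      with * obtain z where z: "z \<in> cls T" "x = e2 z" "y = e2 z" "k < n"
        by (auto simp: composable_inflate)
      have c: "composable M (Suc (Suc k)) (Suc (Suc m)) (M.up m (L2 z)) (M.up m (L2 z))" if "k < m" for m
      proof -
        have "composable (infl T) (Suc (Suc k)) (Suc (Suc m)) x y"
          using that z by (auto simp: composable_inflate)
        from map_composable[OF this] show ?thesis by (simp add: z(2,3))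
      qed
      from M.gcomp_up_same[OF _ z(4) c] z 4 L2 show ?thesis by simp
    qed
  qed
qed

end

text \<open>
  A map in the opposite direction that need not respect composition, such as \<open>\<rho>\<close>.
\<close>

locale graph_section = T: two_magma T + M: two_skeletal_magma M
  for T :: "('x, 'y, 'z) two_data" and M :: "'a omega_magma" +
  fixes R0 :: "'a \<Rightarrow> 'x" and R1 :: "'a \<Rightarrow> 'y" and R2 :: "'a \<Rightarrow> 'z"
  assumes R0: "a \<in> cells M 0 \<Longrightarrow> R0 a \<in> obs T"
    and R1: "f \<in> cells M 1 \<Longrightarrow> R1 f \<in> ars T \<and> s0 T (R1 f) = R0 (gdom M 0 f) \<and> t0 T (R1 f) = R0 (gcod M 0 f)"
    and R2: "x \<in> cells M 2 \<Longrightarrow> R2 x \<in> cls T \<and> s1 T (R2 x) = R1 (gdom M 1 x) \<and> t1 T (R2 x) = R1 (gcod M 1 x)"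
    and R_u0: "a \<in> cells M 0 \<Longrightarrow> R1 (gid M 0 a) = u0 T (R0 a)"
    and R_u1: "f \<in> cells M 1 \<Longrightarrow> R2 (gid M 1 f) = u1 T (R1 f)"

context encoding
begin

definition lift_section :: "'a omega_magma \<Rightarrow> ('a \<Rightarrow> 'x) \<Rightarrow> ('a \<Rightarrow> 'y) \<Rightarrow> ('a \<Rightarrow> 'z) \<Rightarrow> nat \<Rightarrow> 'a \<Rightarrow> 't" where
  "lift_section M R0 R1 R2 n = by_dim (e0 \<circ> R0) (e1 \<circ> R1) (e2 \<circ> R2 \<circ> two_skeletal_magma.down M (n - 2)) n"

lemma lift_section_simps [simp]:
  "lift_section M R0 R1 R2 0 a = e0 (R0 a)"
  "lift_section M R0 R1 R2 (Suc 0) f = e1 (R1 f)"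
  "lift_section M R0 R1 R2 (Suc (Suc n)) x = e2 (R2 (two_skeletal_magma.down M n x))"
  by (simp_all add: lift_section_def)

lemma graph_lift_section:
  assumes "graph_section T M R0 R1 R2"
  shows "omega_graph_morphism M (infl T) (lift_section M R0 R1 R2)"
proof -
  interpret graph_section T M R0 R1 R2 by fact
  interpret T': omega_magma "infl T" by (rule omega_magma_inflate) unfold_locales
  note R1' = R1[unfolded One_nat_def] and R2' = R2[unfolded numeral_2_eq_2 One_nat_def]
    and Ru = R_u0 R_u1[unfolded One_nat_def]
  show ?thesis
  proof
    fix x i assume x: "x \<in> cells M i"
    show "lift_section M R0 R1 R2 i x \<in> cells (infl T) i"
      using x by (cases i rule: dim_cases) (auto simp: R0 R1' R2 M.down_closed)
    show "lift_section M R0 R1 R2 (Suc i) (gid M i x) = gid (infl T) i (lift_section M R0 R1 R2 i x)"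
      using x by (cases i rule: dim_cases) (auto simp: Ru M.gdom_gid)
  next
    fix x i assume "x \<in> cells M (Suc i)"
    then show "lift_section M R0 R1 R2 i (gdom M i x) = gdom (infl T) i (lift_section M R0 R1 R2 (Suc i) x)"
      "lift_section M R0 R1 R2 i (gcod M i x) = gcod (infl T) i (lift_section M R0 R1 R2 (Suc i) x)"
      by (cases i rule: dim_cases; simp add: R1' R2' M.degenerate)+
  qed
qed

end


section \<open>The weak omega category of a bicategory\<close>

context bicategory
begin

abbreviation "magma \<equiv> omega_magma.truncate A"

lemma two_skeletal_truncate: "two_skeletal_magma magma"
  using omega_magma_truncate two_skeletal
  by (simp add: two_skeletal_magma_def two_skeletal_magma_axioms_def skeletal_def)

lemma realisation_resolution: "realisation resolution magma id (dm \<circ> snd) (snd \<circ> snd)"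
proof -
  interpret M: two_skeletal_magma magma by (rule two_skeletal_truncate)
  interpret T: two_magma resolution by (rule two_magma_resolution)
  show ?thesis
    by unfold_locales (auto simp: resolution_cells resolution_ops simp del: \<mu>.simps)
qed

text \<open>
  A 1-cell \<open>f\<close> is sent to the path \<open>[f]\<close>, whose evaluation is \<open>f \<odot> U (tgt f)\<close>. Identity 1-cells are
  the exception, since \<open>\<rho>\<close> has to preserve identities: they are sent to empty paths.
\<close>

definition section1 :: "'a \<Rightarrow> ('a list \<times> 'a) \<times> 'a" where
  "section1 f = (if f \<in> U ` cells A 0 then (([], tgt f), I f) else (([f], tgt f), vinv (runit A f)))"

definition section2 :: "'a \<Rightarrow> (('a list \<times> 'a) \<times> 'a) \<times> (('a list \<times> 'a) \<times> 'a) \<times> 'a" where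
  "section2 \<alpha> = (section1 (dm \<alpha>), section1 (cd \<alpha>), \<alpha>)"

lemma section1:
  assumes "ar f"
  obtains p \<nu> where "section1 f = ((p, tgt f), \<nu>)" "is_path p (tgt f)" "psrc p (tgt f) = src f"
    "isoc \<nu>" "dm \<nu> = f" "cd \<nu> = ev p (tgt f)"
  using assms by (cases "f \<in> U ` cells A 0") (auto simp: section1_def)

lemma graph_section_resolution: "graph_section resolution magma id section1 section2"
proof -
  interpret M: two_skeletal_magma magma by (rule two_skeletal_truncate)
  interpret T: two_magma resolution by (rule two_magma_resolution)
  show ?thesis
  proof
    fix f assume "f \<in> cells magma 1"
    then have f: "ar f" by simp
    then obtain p \<nu> where "section1 f = ((p, tgt f), \<nu>)" "is_path p (tgt f)" "psrc p (tgt f) = src f"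
      "isoc \<nu>" "dm \<nu> = f" "cd \<nu> = ev p (tgt f)" by (rule section1)
    with f show "section1 f \<in> ars resolution \<and> s0 resolution (section1 f) = id (gdom magma 0 f)
        \<and> t0 resolution (section1 f) = id (gcod magma 0 f)"
      and "section2 (gid magma 1 f) = u1 resolution (section1 f)"
      by (simp_all add: resolution_cells resolution_ops section2_def)
  next
    fix \<alpha> assume "\<alpha> \<in> cells magma 2"
    then have a: "ce \<alpha>" by simp
    obtain p \<nu> where "section1 (dm \<alpha>) = ((p, tgt (dm \<alpha>)), \<nu>)" "is_path p (tgt (dm \<alpha>))"
      "psrc p (tgt (dm \<alpha>)) = src (dm \<alpha>)" "isoc \<nu>" "dm \<nu> = dm \<alpha>" "cd \<nu> = ev p (tgt (dm \<alpha>))"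
      using section1[of "dm \<alpha>"] a by auto
    moreover obtain q \<nu>' where "section1 (cd \<alpha>) = ((q, tgt (dm \<alpha>)), \<nu>')" "is_path q (tgt (dm \<alpha>))"
      "psrc q (tgt (dm \<alpha>)) = src (dm \<alpha>)" "isoc \<nu>'" "dm \<nu>' = cd \<alpha>" "cd \<nu>' = ev q (tgt (dm \<alpha>))"
      using section1[of "cd \<alpha>"] a by auto
    ultimately show "section2 \<alpha> \<in> cls resolution \<and> s1 resolution (section2 \<alpha>) = section1 (gdom magma 1 \<alpha>)
        \<and> t1 resolution (section2 \<alpha>) = section1 (gcod magma 1 \<alpha>)"
      using a by (simp add: resolution_cells resolution_ops section2_def)
  qed (auto simp: resolution_ops section1_def)
qed

end

text \<open>
  The \<open>e\<close> encode the cells of the resolution, the \<open>d\<close> those of the strictification.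
\<close>

locale bicategory_encoding = bicategory A + encoding_pair e0 e1 e2 d0 d1 d2
  for A :: "('a, 'm) bicategory_scheme" (structure)
    and e0 :: "'a \<Rightarrow> 's" and e1 :: "('a list \<times> 'a) \<times> 'a \<Rightarrow> 's"
    and e2 :: "(('a list \<times> 'a) \<times> 'a) \<times> (('a list \<times> 'a) \<times> 'a) \<times> 'a \<Rightarrow> 's"
    and d0 :: "'a \<Rightarrow> 't" and d1 :: "'a list \<times> 'a \<Rightarrow> 't"
    and d2 :: "('a list \<times> 'a) \<times> ('a list \<times> 'a) \<times> 'a \<Rightarrow> 't"
begin

definition weak_category :: "('a, 's, 't) weak_omega_category" where
  "weak_category =
    \<lparr> magma1 = magma,
      magma2 = E.infl resolution,
      magma3 = D.infl strictification,
      lam = E.realise magma id (dm \<circ> snd) (snd \<circ> snd),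
      rho = E.lift_section magma id section1 section2,
      bridge = inflate_bridge resolution coherence_cells,
      kap = inflate_map id fst straighten \<rparr>"

lemma weak_category_simps [simp]:
  "magma1 weak_category = magma"
  "magma2 weak_category = E.infl resolution"
  "magma3 weak_category = D.infl strictification"
  "lam weak_category = E.realise magma id (dm \<circ> snd) (snd \<circ> snd)"
  "kap weak_category = inflate_map id fst straighten"
  by (simp_all add: weak_category_def)

lemma weak_category: "weak_omega_category weak_category"
proof -
  interpret M: two_skeletal_magma magma by (rule two_skeletal_truncate)
  have sec: "E.realise magma id (dm \<circ> snd) (snd \<circ> snd) i (E.lift_section magma id section1 section2 i x) = x"
    if x: "x \<in> cells magma i" for x i
  proof (cases i rule: dim_cases)
    case 2
    with x have "ar x" by (simp add: One_nat_def)
    from this show ?thesis by (rule section1) (simp add: 2)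
  next
    case (3 n)
    with x M.up_down[of x n] show ?thesis by (simp add: section2_def)
  qed simp
  show ?thesis
    unfolding weak_category_def
    by (rule weak_omega_category.intro)
      (simp_all add: M.omega_magma_axioms sec E.omega_magma_inflate two_magma_resolution
        E.magma_realise realisation_resolution E.graph_lift_section graph_section_resolution
        penon_inflate_map[OF penon_straighten] D.strict_omega_category_inflate strict_strictification
        del: truncate_simps)
qed

lemma weak_skeletal_weak_category: "weak_skeletal 2 weak_category"
  using two_skeletal by (simp add: weak_skeletal_def skeletal_def)

end

section \<open>The pseudo-functor of a homomorphism\<close>

context homomorphism
begin

lemma h0 [simp]: "A.ob a \<Longrightarrow> B.ob (h 0 a)"
  by (rule map_closed)

lemma h1 [simp]:
  assumes "A.ar f"
  shows "B.ar (h 1 f)" "B.src (h 1 f) = h 0 (A.src f)" "B.tgt (h 1 f) = h 0 (A.tgt f)"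
  using map_closed[of f 1] map_gdom[of f 0] map_gcod[of f 0] assms by (simp_all add: One_nat_def)

lemma h2 [simp]:
  assumes "A.ce \<alpha>"
  shows "B.ce (h 2 \<alpha>)" "B.dm (h 2 \<alpha>) = h 1 (A.dm \<alpha>)" "B.cd (h 2 \<alpha>) = h 1 (A.cd \<alpha>)"
  using map_closed[of \<alpha> 2] map_gdom[of \<alpha> 1] map_gcod[of \<alpha> 1] assms
  by (simp_all add: One_nat_def numeral_2_eq_2)

lemma h_vcomp: "A.ce \<alpha> \<Longrightarrow> A.ce \<beta> \<Longrightarrow> A.cd \<alpha> = A.dm \<beta> \<Longrightarrow> h 2 (\<alpha> \<cdot>\<^bsub>A\<^esub> \<beta>) = h 2 \<alpha> \<cdot>\<^bsub>B\<^esub> h 2 \<beta>"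
  by (rule hom_vcomp) (simp add: A.composable12)

lemma h_inverses:
  assumes "A.isoc \<alpha>"
  shows "B.inverses (h 2 \<alpha>) (h 2 (A.vinv \<alpha>))"
  using assms h_vcomp[of \<alpha> "A.vinv \<alpha>"] h_vcomp[of "A.vinv \<alpha>" \<alpha>]
  by (simp add: B.inverses_def hom_id)

lemma
  assumes "A.isoc \<alpha>"
  shows h_isoc [simp]: "B.isoc (h 2 \<alpha>)"
    and h_vinv: "h 2 (A.vinv \<alpha>) = B.vinv (h 2 \<alpha>)"
  using h_inverses[OF assms] B.isoc_def B.vinv_eqI by metis+

lemma h_path [simp]:
  assumes "A.is_path p b"
  shows "B.is_path (map (h 1) p) (h 0 b)" "B.psrc (map (h 1) p) (h 0 b) = h 0 (A.psrc p b)"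
proof -
  have "B.is_path (map (h 1) p) (h 0 b) \<and> B.psrc (map (h 1) p) (h 0 b) = h 0 (A.psrc p b)"
    using assms by (induction p) auto
  then show "B.is_path (map (h 1) p) (h 0 b)" "B.psrc (map (h 1) p) (h 0 b) = h 0 (A.psrc p b)"
    by auto
qed

text \<open>
  The homomorphism constraints, inverted and iterated along the path: the unit constraint at its end
  and the composition constraint at each 1-cell.
\<close>

lemma comparison_exists:
  assumes "A.is_path p b"
  shows "\<exists>\<theta>. B.isoc \<theta> \<and> B.dm \<theta> = h 1 (A.ev p b) \<and> B.cd \<theta> = B.ev (map (h 1) p) (h 0 b)"
  using assms
proof (induction p)
  case Nil
  then have "B.isoc (\<phi>0 b)" "B.dm (\<phi>0 b) = gid B 0 (h 0 b)" "B.cd (\<phi>0 b) = h 1 (gid A 0 b)"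
    using \<phi>0_iso[of b] by (simp_all add: B.isoc_iff)
  then show ?case by (intro exI[of _ "B.vinv (\<phi>0 b)"]) simp
next
  case (Cons f p)
  then obtain \<theta> where t: "B.isoc \<theta>" "B.dm \<theta> = h 1 (A.ev p b)" "B.cd \<theta> = B.ev (map (h 1) p) (h 0 b)"
    by auto
  have f: "A.ar f" "A.is_path p b" "A.tgt f = A.psrc p b" using Cons.prems by auto
  then have "B.isoc (\<phi> f (A.ev p b))" "B.dm (\<phi> f (A.ev p b)) = h 1 f \<odot>\<^bsub>B\<^esub> h 1 (A.ev p b)"
    "B.cd (\<phi> f (A.ev p b)) = h 1 (f \<odot>\<^bsub>A\<^esub> A.ev p b)"
    using \<phi>_iso[of f "A.ev p b"] by (simp_all add: A.composable01 B.isoc_iff)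
  then show ?case using t f
    by (intro exI[of _ "B.vinv (\<phi> f (A.ev p b)) \<cdot>\<^bsub>B\<^esub> (gid B 1 (h 1 f) \<star>\<^bsub>B\<^esub> \<theta>)"]) simp
qed

text \<open>
  Conjugation by any invertible cell of this type yields the equations below, so the choice is left
  open.
\<close>

definition comparison :: "'a list \<times> 'a \<Rightarrow> 'b" where
  "comparison P = (SOME \<theta>. B.isoc \<theta> \<and> B.dm \<theta> = h 1 (A.ev (fst P) (snd P)) \<and>
    B.cd \<theta> = B.ev (map (h 1) (fst P)) (h 0 (snd P)))"

lemma comparison [simp]:
  assumes "A.is_path p b"
  shows "B.isoc (comparison (p, b))" "B.dm (comparison (p, b)) = h 1 (A.ev p b)"
    "B.cd (comparison (p, b)) = B.ev (map (h 1) p) (h 0 b)"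
  using someI_ex[OF comparison_exists[OF assms]] unfolding comparison_def by auto

lemma ce_comparison [simp]: "A.is_path p b \<Longrightarrow> B.ce (comparison (p, b))"
  by (rule B.vinv_simps(1)) simp

definition path_map where "path_map = (\<lambda>(p, b). (map (h 1) p, h 0 b))"

definition strict_map2 where
  "strict_map2 = (\<lambda>(P, Q, \<alpha>). (path_map P, path_map Q, B.vinv (comparison P) \<cdot>\<^bsub>B\<^esub> (h 2 \<alpha> \<cdot>\<^bsub>B\<^esub> comparison Q)))"

definition res_map1 where
  "res_map1 = (\<lambda>(P, \<nu>). (path_map P, h 2 \<nu> \<cdot>\<^bsub>B\<^esub> comparison P))"

definition res_map2 where "res_map2 = (\<lambda>(S, T, \<alpha>). (res_map1 S, res_map1 T, h 2 \<alpha>))"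

lemma map_simps [simp]:
  "path_map (p, b) = (map (h 1) p, h 0 b)"
  "strict_map2 (P, Q, \<alpha>) = (path_map P, path_map Q, B.vinv (comparison P) \<cdot>\<^bsub>B\<^esub> (h 2 \<alpha> \<cdot>\<^bsub>B\<^esub> comparison Q))"
  "res_map1 (P, \<nu>) = (path_map P, h 2 \<nu> \<cdot>\<^bsub>B\<^esub> comparison P)"
  "res_map2 (S, T, \<alpha>) = (res_map1 S, res_map1 T, h 2 \<alpha>)"
  by (simp_all add: path_map_def strict_map2_def res_map1_def res_map2_def)

lemmas cells_ops = A.strictification_cells A.strictification_ops A.resolution_cells A.resolution_ops
  B.strictification_cells B.strictification_ops B.resolution_cells B.resolution_ops

text \<open>
  Conjugating with comparisons preserves identities whatever the comparisons are.
\<close>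

lemma graph_map_strictification:
  "two_graph_map A.strictification B.strictification (h 0) path_map strict_map2"
proof -
  interpret X: strict_two_category A.strictification by (rule A.strict_strictification)
  interpret Y: strict_two_category B.strictification by (rule B.strict_strictification)
  show ?thesis
    by unfold_locales (auto simp: cells_ops hom_id)
qed

lemma globular_map_resolution:
  "two_globular_map A.resolution B.resolution (h 0) res_map1 res_map2"
proof -
  interpret X: two_magma A.resolution by (rule A.two_magma_resolution)
  interpret Y: two_magma B.resolution by (rule B.two_magma_resolution)
  show ?thesis
    by unfold_locales (auto simp: cells_ops)
qed

text \<open>
  The square of \<open>\<kappa>\<close> with the pseudo-functor commutes because \<open>res_map1\<close> prolongs \<open>\<nu>\<close> by exactly
  the comparison with which \<open>strict_map2\<close> conjugates.
\<close>

lemma straighten_res_map2: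
  "x \<in> cls A.resolution \<Longrightarrow> strict_map2 (A.straighten x) = B.straighten (res_map2 x)"
  by (auto simp: cells_ops B.vinv_of_vcomp h_vinv h_vcomp B.vassoc)

text \<open>
  Above dimension 2, compatibility with boundaries alone forces \<open>h\<close> to preserve iterated identities.
\<close>

lemma h_up:
  assumes "A.ce \<alpha>"
  shows "h (Suc (Suc n)) (two_skeletal_magma.up A.magma n \<alpha>) = two_skeletal_magma.up B.magma n (h 2 \<alpha>)"
proof -
  interpret X: two_skeletal_magma A.magma by (rule A.two_skeletal_truncate)
  interpret Y: two_skeletal_magma B.magma by (rule B.two_skeletal_truncate)
  have c: "X.up n \<alpha> \<in> cells A (Suc (Suc n))" "Y.up n (h 2 \<alpha>) \<in> cells B (Suc (Suc n))" for n
    using X.up_closed[of \<alpha> n] Y.up_closed[of "h 2 \<alpha>" n] assms by simp_all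
  show ?thesis
  proof (induction n)
    case 0
    then show ?case by (simp add: numeral_2_eq_2)
  next
    case (Suc n)
    have "gdom B (Suc (Suc n)) (h (Suc (Suc (Suc n))) (X.up (Suc n) \<alpha>)) = gdom B (Suc (Suc n)) (Y.up (Suc n) (h 2 \<alpha>))"
      using map_gdom[OF c(1)[of "Suc n"]] Suc X.up_Suc_ends[of \<alpha> n] Y.up_Suc_ends[of "h 2 \<alpha>" n] assms
      by (simp del: X.up.simps Y.up.simps)
    then show ?case
      using Y.up_unique[of "h (Suc (Suc (Suc n))) (X.up (Suc n) \<alpha>)" n "Y.up (Suc n) (h 2 \<alpha>)"]
        map_closed[OF c(1)[of "Suc n"]] c(2)[of "Suc n"]
      by (simp del: X.up.simps Y.up.simps)
  qed
qed

lemma globular_truncate: "globular_morphism A.magma B.magma h"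
proof -
  interpret X: two_skeletal_magma A.magma by (rule A.two_skeletal_truncate)
  interpret Y: two_skeletal_magma B.magma by (rule B.two_skeletal_truncate)
  show ?thesis
    by unfold_locales (simp_all add: map_closed map_gdom map_gcod)
qed

end

locale homomorphism_encoding = homomorphism A B h \<phi> \<phi>0 +
    X: bicategory_encoding A e0 e1 e2 d0 d1 d2 + Y: bicategory_encoding B e0' e1' e2' d0' d1' d2'
  for A :: "('a, 'm) bicategory_scheme" and B :: "('b, 'n) bicategory_scheme"
    and h :: "nat \<Rightarrow> 'a \<Rightarrow> 'b" and \<phi> \<phi>0
    and e0 :: "'a \<Rightarrow> 's" and e1 e2 and d0 :: "'a \<Rightarrow> 't" and d1 d2
    and e0' :: "'b \<Rightarrow> 'u" and e1' e2' and d0' :: "'b \<Rightarrow> 'v" and d1' d2'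
begin

sublocale F2: encoding_pair e0 e1 e2 e0' e1' e2'
  by unfold_locales

sublocale F3: encoding_pair d0 d1 d2 d0' d1' d2'
  by unfold_locales

lemma pseudo_functor:
  "omega_pseudo_functor X.weak_category Y.weak_category h
    (F2.inflate_map (h 0) res_map1 res_map2) (F3.inflate_map (h 0) path_map strict_map2)"
proof -
  note [simp] = cells_ops
  show ?thesis
  proof (intro omega_pseudo_functor.intro omega_pseudo_functor_axioms.intro X.weak_category Y.weak_category)
    show "globular_morphism (magma1 X.weak_category) (magma1 Y.weak_category) h"
      using globular_truncate by simp
    show "globular_morphism (magma2 X.weak_category) (magma2 Y.weak_category) (F2.inflate_map (h 0) res_map1 res_map2)"
      using F2.globular_inflate_map[OF globular_map_resolution] by simp
    show "omega_graph_morphism (magma3 X.weak_category) (magma3 Y.weak_category) (F3.inflate_map (h 0) path_map strict_map2)"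
      using F3.graph_inflate_map[OF graph_map_strictification] by simp
  next
    fix x i assume x: "x \<in> cells (magma2 X.weak_category) i"
    consider a where "i = 0" "a \<in> obs A.resolution" "x = e0 a"
      | S where "i = Suc 0" "S \<in> ars A.resolution" "x = e1 S"
      | n y where "i = Suc (Suc n)" "y \<in> cls A.resolution" "x = e2 y"
      using x by (cases i rule: dim_cases) (auto simp del: cells_ops)
    then have "h i (lam X.weak_category i x) = lam Y.weak_category i (F2.inflate_map (h 0) res_map1 res_map2 i x) \<and>
      F3.inflate_map (h 0) path_map strict_map2 i (kap X.weak_category i x)
        = kap Y.weak_category i (F2.inflate_map (h 0) res_map1 res_map2 i x)"
    proof cases
      case 1
      then show ?thesis by simp
    next
      case 2
      then obtain p b \<nu> where S: "S = ((p, b), \<nu>)" "A.is_path p b" "A.isoc \<nu>" "A.cd \<nu> = A.ev p b"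
        by auto
      then have "h (Suc 0) (A.dm \<nu>) = B.dm (h 2 \<nu> \<cdot>\<^bsub>B\<^esub> comparison (p, b))"
        by (simp flip: One_nat_def)
      with 2(1,3) S(1) show ?thesis by simp
    next
      case (3 n y)
      then obtain S T \<alpha> where "y = (S, T, \<alpha>)" "A.ce \<alpha>" by auto
      with 3 straighten_res_map2[of y] show ?thesis
        by (simp add: h_up del: cells_ops A.straighten_simps B.straighten_simps)
    qed
    then show "h i (lam X.weak_category i x) = lam Y.weak_category i (F2.inflate_map (h 0) res_map1 res_map2 i x)"
      and "F3.inflate_map (h 0) path_map strict_map2 i (kap X.weak_category i x)
        = kap Y.weak_category i (F2.inflate_map (h 0) res_map1 res_map2 i x)"
      by blast+
  next
    fix j a b assume "composable (magma2 X.weak_category) j (Suc j) a b"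
    then show "kap Y.weak_category (Suc j) (gcomp (magma2 Y.weak_category) j (Suc j)
          (F2.inflate_map (h 0) res_map1 res_map2 (Suc j) a) (F2.inflate_map (h 0) res_map1 res_map2 (Suc j) b))
      = kap Y.weak_category (Suc j) (F2.inflate_map (h 0) res_map1 res_map2 (Suc j) (gcomp (magma2 X.weak_category) j (Suc j) a b))"
      by (cases j rule: dim_cases; auto simp: X.E.composable_inflate h_vcomp)
  qed
qed

end


section \<open>Encoding in trees\<close>

text \<open>
  Only injectivity within one dimension matters, since cells of different dimensions may share
  codes; hence the constant label at inner nodes. The end object comes first in the list of a path.
\<close>

definition code_path :: "('a \<Rightarrow> 'g) \<Rightarrow> 'a list \<times> 'a \<Rightarrow> 'g tree" where
  "code_path \<iota> = (\<lambda>(p, b). Node 0 (map (Leaf \<circ> \<iota>) (b # p)))"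

definition code_res1 :: "('a \<Rightarrow> 'g) \<Rightarrow> ('a list \<times> 'a) \<times> 'a \<Rightarrow> 'g tree" where
  "code_res1 \<iota> = (\<lambda>(P, \<nu>). Node 0 [code_path \<iota> P, Leaf (\<iota> \<nu>)])"

definition code_cell :: "('y \<Rightarrow> 'g tree) \<Rightarrow> ('a \<Rightarrow> 'g) \<Rightarrow> 'y \<times> 'y \<times> 'a \<Rightarrow> 'g tree" where
  "code_cell k \<iota> = (\<lambda>(S, T, \<alpha>). Node 0 [k S, k T, Leaf (\<iota> \<alpha>)])"

lemma inj_codes:
  assumes "inj \<iota>"
  shows "inj (Leaf \<circ> \<iota>)" "inj (code_path \<iota>)" "inj (code_res1 \<iota>)" "inj k \<Longrightarrow> inj (code_cell k \<iota>)"
proof -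
  show 0: "inj (Leaf \<circ> \<iota>)"
    using assms by (auto simp: inj_def)
  show 1: "inj (code_path \<iota>)"
    using inj_mapI[OF 0] assms by (auto simp: code_path_def inj_def)
  show "inj (code_res1 \<iota>)"
    using assms 1 by (auto simp: code_res1_def inj_def)
  show "inj k \<Longrightarrow> inj (code_cell k \<iota>)"
    using assms by (auto simp: code_cell_def inj_def)
qed

lemma encoding_codes:
  assumes "inj \<iota>"
  shows "encoding (Leaf \<circ> \<iota>) (code_res1 \<iota>) (code_cell (code_res1 \<iota>) \<iota>)"
    and "encoding (Leaf \<circ> \<iota>) (code_path \<iota>) (code_cell (code_path \<iota>) \<iota>)"
  using inj_codes[OF assms] by (simp_all add: encoding_def)

theorem theorem35:
  fixes A :: "'a bicategory" and B :: "'b bicategory"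
    and h :: "nat \<Rightarrow> 'a \<Rightarrow> 'b" and \<phi> :: "'a \<Rightarrow> 'a \<Rightarrow> 'b" and \<phi>0 :: "'a \<Rightarrow> 'b"
  assumes "homomorphism A B h \<phi> \<phi>0"
    and "proper A B h \<phi> \<phi>0"
  shows "\<exists>(X :: ('a, ('a + 'b) tree, ('a + 'b) tree) weak_omega_category)
          (Y :: ('b, ('a + 'b) tree, ('a + 'b) tree) weak_omega_category) F1 F2 F3.
           weak_omega_category X \<and> weak_skeletal 2 X \<and>
           weak_omega_category Y \<and> weak_skeletal 2 Y \<and>
           omega_pseudo_functor X Y F1 F2 F3 \<and>
           magma1 X = omega_magma.truncate A \<and>
           magma1 Y = omega_magma.truncate B \<and>
           F1 = h"
proof -
  interpret homomorphism A B h \<phi> \<phi>0 by fact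
  let ?l = "Inl :: 'a \<Rightarrow> 'a + 'b" and ?r = "Inr :: 'b \<Rightarrow> 'a + 'b"
  interpret homomorphism_encoding A B h \<phi> \<phi>0
    "Leaf \<circ> ?l" "code_res1 ?l" "code_cell (code_res1 ?l) ?l"
    "Leaf \<circ> ?l" "code_path ?l" "code_cell (code_path ?l) ?l"
    "Leaf \<circ> ?r" "code_res1 ?r" "code_cell (code_res1 ?r) ?r"
    "Leaf \<circ> ?r" "code_path ?r" "code_cell (code_path ?r) ?r"
    by (intro homomorphism_encoding.intro bicategory_encoding.intro encoding_pair.intro encoding_codes inj_Inl inj_Inr)
      unfold_locales
  show ?thesis
    using X.weak_category X.weak_skeletal_weak_category Y.weak_category Y.weak_skeletal_weak_category
      pseudo_functor X.weak_category_simps(1) Y.weak_category_simps(1)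
    by blast
qed

end
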